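(* Let $G$ be a branch group. Then $G$ does not admit a quasi-$2$-transitive action on any infinite set.
   Context: An action of a group $G$ on a set $X$ is quasi-$2$-transitive if the diagonal action of $G$ on $X^2$ has only finitely many orbits. Here $\mathbb{N}=\{0,1,2,\dots\}$. Let $(A_i)_{i\in\mathbb{N}}$ be a sequence of finite sets with $|A_i|\ge 2$. The associated (spherically homogeneous) rooted tree $T$ has as vertices all finite words $v=(a_0,\dots,a_{k-1})\in A_0\times\cdots\times A_{k-1}$, $k\ge 0$, with root the empty word; $|v|=k$ is the length of $v$; $v\le w$ means that $v$ is a prefix of $w$; $v$ and $w$ are adjacent if $v\le w$ and $|w|=|v|+1$ (or vice versa). The $n$th level $\mathcal{L}_n$ is the set of vertices of length $n$, and $T_v$ is the subtree of all $w\ge v$. $\operatorname{Aut}(T)$ is the group of graph automorphisms of $T$ fixing the root. For $G\le\operatorname{Aut}(T)$ and $v\in T$, $\operatorname{Rist}_G(v)=\{g\in G: gw=w \text{ for all } w\notin T_v\}$, and $\operatorname{Rist}_G(n)$ is the subgroup generated by all $\operatorname{Rist}_G(v)$, $v\in\mathcal{L}_n$. $G\le\operatorname{Aut}(T)$ is a branch group if $G$ acts transitively on $\mathcal{L}_n$ for every $n\in\mathbb{N}$ and $\operatorname{Rist}_G(n)$ has finite index in $G$ for every $n\in\mathbb{N}$. *)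

theory Defs
  imports "HOL-Algebra.Group_Action" "HOL-Algebra.Generated_Groups" "HOL-Library.Sublist"
begin

section \<open>Quasi-2-transitive actions\<close>

definition diagonal_action :: "'x set \<Rightarrow> ('g \<Rightarrow> 'x \<Rightarrow> 'x) \<Rightarrow> 'g \<Rightarrow> 'x \<times> 'x \<Rightarrow> 'x \<times> 'x" where
  "diagonal_action \<Omega> \<phi> g = (\<lambda>p \<in> \<Omega> \<times> \<Omega>. (\<phi> g (fst p), \<phi> g (snd p)))"

locale quasi_2_transitive_action = group_action G \<Omega> \<phi>
  for G (structure) and \<Omega> and \<phi> +
  assumes finite_orbits_diagonal: "finite (orbits G (\<Omega> \<times> \<Omega>) (diagonal_action \<Omega> \<phi>))"


section \<open>Spherically homogeneous rooted trees\<close>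

text \<open>Vertices are words, represented as lists whose letter at position \<open>i\<close> lies in \<open>A i\<close>.
  A common type for all alphabets is no restriction, since the alphabets are finite.\<close>

locale rooted_tree =
  fixes A :: "nat \<Rightarrow> 'a set"
  assumes finite_alphabet: "\<And>i. finite (A i)"
    and card_alphabet: "\<And>i. card (A i) \<ge> 2"

definition vertices :: "(nat \<Rightarrow> 'a set) \<Rightarrow> 'a list set" where
  "vertices A = {v. \<forall>i < length v. v ! i \<in> A i}"

definition level :: "(nat \<Rightarrow> 'a set) \<Rightarrow> nat \<Rightarrow> 'a list set" where
  "level A n = {v \<in> vertices A. length v = n}"

definition subtree :: "(nat \<Rightarrow> 'a set) \<Rightarrow> 'a list \<Rightarrow> 'a list set" where
  "subtree A v = {w \<in> vertices A. prefix v w}"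

definition adjacent :: "'a list \<Rightarrow> 'a list \<Rightarrow> bool" where
  "adjacent v w \<longleftrightarrow>
     prefix v w \<and> length w = Suc (length v) \<or> prefix w v \<and> length v = Suc (length w)"

definition tree_automorphisms :: "(nat \<Rightarrow> 'a set) \<Rightarrow> ('a list \<Rightarrow> 'a list) set" where
  "tree_automorphisms A =
     {g \<in> Bij (vertices A).
        (\<forall>v \<in> vertices A. \<forall>w \<in> vertices A. adjacent (g v) (g w) \<longleftrightarrow> adjacent v w) \<and> g [] = []}"

definition AutTree :: "(nat \<Rightarrow> 'a set) \<Rightarrow> ('a list \<Rightarrow> 'a list) monoid" where
  "AutTree A = (BijGroup (vertices A))\<lparr>carrier := tree_automorphisms A\<rparr>"

lemma Nil_in_vertices [simp]: "[] \<in> vertices A"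
  by (simp add: vertices_def)

lemma subgroup_tree_automorphisms:
  "subgroup (tree_automorphisms A) (BijGroup (vertices A))"
proof -
  let ?V = "vertices A"
  interpret B: group "BijGroup ?V" by (rule group_BijGroup)
  show ?thesis
  proof (rule B.subgroupI)
    show "tree_automorphisms A \<subseteq> carrier (BijGroup ?V)"
      by (auto simp: tree_automorphisms_def BijGroup_def)
    have "(\<lambda>x \<in> ?V. x) \<in> tree_automorphisms A"
      by (simp add: tree_automorphisms_def id_Bij)
    then show "tree_automorphisms A \<noteq> {}" by blast
  next
    fix g assume g: "g \<in> tree_automorphisms A"
    then have gB: "g \<in> Bij ?V" and gadj: "\<And>v w. \<lbrakk>v \<in> ?V; w \<in> ?V\<rbrakk> \<Longrightarrow> adjacent (g v) (g w) = adjacent v w"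
      and g0: "g [] = []"
      by (auto simp: tree_automorphisms_def)
    then have bij: "bij_betw g ?V ?V" by (simp add: Bij_def)
    let ?h = "inv_into ?V g"
    have hV: "?h v \<in> ?V" and gh: "g (?h v) = v" if "v \<in> ?V" for v
      using bij that by (auto simp: bij_betw_def inv_into_into f_inv_into_f)
    have "adjacent (?h v) (?h w) = adjacent v w" if "v \<in> ?V" "w \<in> ?V" for v w
      using gadj[OF hV hV] gh that by metis
    moreover have "?h [] = []"
      by (metis Nil_in_vertices bij bij_betw_def g0 inv_into_f_f)
    ultimately show "inv\<^bsub>BijGroup ?V\<^esub> g \<in> tree_automorphisms A"
      using gB by (simp add: tree_automorphisms_def inv_BijGroup restrict_inv_into_Bij)
  next
    fix g h assume "g \<in> tree_automorphisms A" "h \<in> tree_automorphisms A"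
    then show "g \<otimes>\<^bsub>BijGroup ?V\<^esub> h \<in> tree_automorphisms A"
      using Bij_imp_funcset[of h ?V]
      by (auto simp: tree_automorphisms_def BijGroup_def compose_Bij compose_eq Pi_iff)
  qed
qed

lemma group_AutTree: "group (AutTree A)"
  unfolding AutTree_def
  by (rule subgroup.subgroup_is_group[OF subgroup_tree_automorphisms group_BijGroup])


section \<open>Branch groups\<close>

definition rist :: "(nat \<Rightarrow> 'a set) \<Rightarrow> ('a list \<Rightarrow> 'a list) set \<Rightarrow> 'a list \<Rightarrow> ('a list \<Rightarrow> 'a list) set" where
  "rist A G v = {g \<in> G. \<forall>w \<in> vertices A - subtree A v. g w = w}"

definition rist_level :: "(nat \<Rightarrow> 'a set) \<Rightarrow> ('a list \<Rightarrow> 'a list) set \<Rightarrow> nat \<Rightarrow> ('a list \<Rightarrow> 'a list) set" where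
  "rist_level A G n = generate (AutTree A) (\<Union>v \<in> level A n. rist A G v)"

locale branch_group = rooted_tree A
  for A :: "nat \<Rightarrow> 'a set" +
  fixes G :: "('a list \<Rightarrow> 'a list) set"
  assumes subgroup_AutTree: "subgroup G (AutTree A)"
    and level_transitive: "\<And>n v w. \<lbrakk>v \<in> level A n; w \<in> level A n\<rbrakk> \<Longrightarrow> \<exists>g \<in> G. g v = w"
    and finite_index_rist_level:
      "\<And>n. finite (rcosets\<^bsub>(AutTree A)\<lparr>carrier := G\<rparr>\<^esub> (rist_level A G n))"

end

theory Submission
  imports Defs
begin

text \<open>Let \<open>R n\<close> be the rigid level stabilizers, and for a set \<open>S\<close> of vertices of level \<open>n\<close> let
  \<open>R S\<close> be the subgroup generated by the rigid stabilizers of the vertices in \<open>S\<close>. The orbit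
  relations of the groups \<open>R n\<close> form a decreasing sequence of invariant relations, of which there
  are only finitely many, so they stabilize. On an infinite orbit \<open>X\<close> of \<open>R n\<close>, with \<open>n\<close> large, the
  number of vertices needed to move one point to another is bounded independently of \<open>n\<close>, by the
  number of orbits on pairs; hence by B. H. Neumann's covering lemma some \<open>R S\<close> with \<open>S\<close> of
  bounded size has finitely many orbits on \<open>X\<close>. As level \<open>n\<close> is large and \<open>X\<close> is one of boundedly
  many orbits, there are three pairwise disjoint translates of \<open>S\<close> that have this property on one
  and the same orbit. The three corresponding commuting subgroups force a finite index subgroup of one of them to
  act on an infinite orbit through an abelian group on which the point stabilizers act almost
  trivially, which contradicts the finiteness of the number of orbits on pairs.\<close>


section \<open>Combinatorial lemmas\<close>

text \<open>Induction on the index set. If \<open>cls i\<close> has infinitely many classes, some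
  class \<open>cls i z\<close> does not occur in the finite cover, so classes of the other indices
  must cover it. Transporting this cover to every \<open>i\<close>-class of \<open>F\<close> gives a
  cover without \<open>i\<close>; with no index left, nothing covers the nonempty \<open>X\<close>.
  Equivalence classes take the place of cosets, so that the lemma applies directly to
  orbits.\<close>

lemma Neumann_covering:
  fixes cls :: "'i \<Rightarrow> 'x \<Rightarrow> 'x set"
  assumes "finite I" and "X \<noteq> {}"
    and refl: "\<And>i x. \<lbrakk>i \<in> I; x \<in> X\<rbrakk> \<Longrightarrow> x \<in> cls i x"
    and sub: "\<And>i x. \<lbrakk>i \<in> I; x \<in> X\<rbrakk> \<Longrightarrow> cls i x \<subseteq> X"
    and eq: "\<And>i x y. \<lbrakk>i \<in> I; x \<in> X; y \<in> cls i x\<rbrakk> \<Longrightarrow> cls i y = cls i x"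
    and trans: "\<And>x y. \<lbrakk>x \<in> X; y \<in> X\<rbrakk> \<Longrightarrow>
      \<exists>p. p ` X \<subseteq> X \<and> p x = y \<and> (\<forall>i\<in>I. \<forall>z\<in>X. p ` cls i z = cls i (p z))"
    and "finite F" "F \<subseteq> I \<times> X" "X \<subseteq> (\<Union>(i,x)\<in>F. cls i x)"
  shows "\<exists>i\<in>I. finite (cls i ` X)"
  using assms(1,3-)
proof (induction I arbitrary: F rule: finite_induct)
  case empty
  then show ?case using \<open>X \<noteq> {}\<close> by auto
next
  case (insert i I)
  show ?case
  proof (cases "finite (cls i ` X)")
    case False
    define F' where "F' = {jx \<in> F. fst jx \<noteq> i}"
    define Fi where "Fi = {x. (i, x) \<in> F}"
    have finFi: "finite Fi"
      using finite_imageI[OF insert.prems(5), of snd] unfolding Fi_def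
      by (rule finite_subset[rotated]) force
    have FiX: "Fi \<subseteq> X" using insert.prems(6) by (auto simp: Fi_def)
    have "\<not> cls i ` X \<subseteq> cls i ` Fi"
      using False finFi finite_subset by blast
    then obtain z where z: "z \<in> X" "cls i z \<notin> cls i ` Fi" by auto
    have F'X: "F' \<subseteq> I \<times> X" and finF': "finite F'"
      using insert.prems(5,6) by (auto simp: F'_def)
    have zcov: "cls i z \<subseteq> (\<Union>(j,x)\<in>F'. cls j x)"
    proof
      fix y assume y: "y \<in> cls i z"
      then have yX: "y \<in> X" using insert.prems(2)[of i z] z by auto
      then obtain j x where jx: "(j, x) \<in> F" "y \<in> cls j x" using insert.prems(7) by fast
      have "j \<noteq> i"
      proof
        assume "j = i"
        then have "x \<in> Fi" "cls i y = cls i x"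
          using jx insert.prems(3)[of i x y] FiX by (auto simp: Fi_def)
        moreover have "cls i y = cls i z" using insert.prems(3)[of i z y] z y by auto
        ultimately show False using z(2) by auto
      qed
      then show "y \<in> (\<Union>(j,x)\<in>F'. cls j x)" using jx by (auto simp: F'_def)
    qed
    have "\<forall>x\<in>Fi. \<exists>p. p ` X \<subseteq> X \<and> p z = x \<and> (\<forall>i\<in>insert i I. \<forall>z\<in>X. p ` cls i z = cls i (p z))"
      using insert.prems(4) z(1) FiX by blast
    then obtain p where p: "\<And>x. x \<in> Fi \<Longrightarrow> p x ` X \<subseteq> X \<and> p x z = x \<and>
        (\<forall>i\<in>insert i I. \<forall>z\<in>X. p x ` cls i z = cls i (p x z))"
      by metis
    \<comment> \<open>\<open>p x\<close> carries \<open>cls i z\<close> onto \<open>cls i x\<close>,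
      so the images of \<open>F'\<close> under these maps replace the \<open>i\<close>-classes of
      \<open>F\<close>.\<close>
    define F'' where "F'' = F' \<union> (\<Union>x\<in>Fi. (\<lambda>(j,x'). (j, p x x')) ` F')"
    have "\<exists>j\<in>I. finite (cls j ` X)"
    proof (rule insert.IH[of F''])
      show "finite F''" using finF' finFi by (auto simp: F''_def)
      show "F'' \<subseteq> I \<times> X" 
      proof -
        have "(\<lambda>(j, x'). (j, p x x')) ` F' \<subseteq> I \<times> X" if x: "x \<in> Fi" for x
        proof -
          have "p x ` X \<subseteq> X" using p[OF x] by blast
          then show ?thesis using F'X by auto
        qed
        then show ?thesis using F'X unfolding F''_def by (simp only: Un_subset_iff UN_subset_iff) blast
      qed
      show "X \<subseteq> (\<Union>(j,x)\<in>F''. cls j x)"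
      proof
        fix y assume "y \<in> X"
        then obtain j x where jx: "(j, x) \<in> F" "y \<in> cls j x" using insert.prems(7) by fast
        show "y \<in> (\<Union>(j,x)\<in>F''. cls j x)"
        proof (cases "j = i")
          case True
          then have x: "x \<in> Fi" using jx by (auto simp: Fi_def)
          then have "cls i x = p x ` cls i z" using p[OF x] z(1) by auto
          then obtain y' where y': "y' \<in> cls i z" "y = p x y'" using jx True by auto
          then obtain k x' where kx: "(k, x') \<in> F'" "y' \<in> cls k x'" using zcov by fast
          have "k \<in> I" "x' \<in> X" using F'X kx(1) by auto
          then have "p x ` cls k x' = cls k (p x x')" using p[OF x] by simp
          then have "y \<in> cls k (p x x')" using kx(2) y'(2) by blast
          moreover have "(\<lambda>(j, x'). (j, p x x')) (k, x') \<in> F''"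
            unfolding F''_def using kx(1) x by blast
          then have "(k, p x x') \<in> F''" by simp
          ultimately show ?thesis by blast
        next
          case False
          then have "(j, x) \<in> F''" using jx by (auto simp: F''_def F'_def)
          then show ?thesis using jx by blast
        qed
      qed
      show "\<And>x y. \<lbrakk>x \<in> X; y \<in> X\<rbrakk> \<Longrightarrow>
        \<exists>p. p ` X \<subseteq> X \<and> p x = y \<and> (\<forall>i\<in>I. \<forall>z\<in>X. p ` cls i z = cls i (p z))"
        using insert.prems(4) by (meson insertCI)
      show "x \<in> cls i x" if "i \<in> I" "x \<in> X" for i x
        using insert.prems(1) that by blast
      show "cls i x \<subseteq> X" if "i \<in> I" "x \<in> X" for i x
        using insert.prems(2) that by blast
      show "cls i y = cls i x" if "i \<in> I" "x \<in> X" "y \<in> cls i x" for i x y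
        by (rule insert.prems(3)) (use that in simp_all)
    qed
    then show ?thesis by blast
  qed auto
qed

text \<open>Without a repetition up to \<open>card P\<close> the cardinality would rise at every
  step and exceed \<open>card P\<close>. The explicit bound on \<open>j\<close> later bounds a
  number of vertices independently of the level.\<close>

lemma finite_increasing_chain_repeats:
  fixes f :: "nat \<Rightarrow> 'a set"
  assumes "finite P" and "\<And>j. f j \<subseteq> P" and "\<And>j. f j \<subseteq> f (Suc j)"
  shows "\<exists>j \<le> card P. f j = f (Suc j)"
proof (rule ccontr)
  assume neg: "\<not> ?thesis"
  have "k \<le> card (f k)" if "k \<le> Suc (card P)" for k
    using that
  proof (induction k)
    case (Suc k)
    then have "f k \<subset> f (Suc k)" using neg assms(3) by (metis Suc_le_mono psubsetI)
    then have "card (f k) < card (f (Suc k))"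
      using assms(1,2) by (meson finite_subset psubset_card_mono)
    then show ?case using Suc by auto
  qed auto
  then have "Suc (card P) \<le> card (f (Suc (card P)))" by blast
  also have "\<dots> \<le> card P" using assms by (simp add: card_mono)
  finally show False by simp
qed

lemma finite_decreasing_chain_stabilizes:
  fixes f :: "nat \<Rightarrow> 'a set"
  assumes "finite P" and "\<And>j. f j \<subseteq> P" and dec: "\<And>j. f (Suc j) \<subseteq> f j"
  shows "\<exists>m. \<forall>n\<ge>m. f n = f m"
proof -
  \<comment> \<open>An index of minimal cardinality: every later set lies in \<open>f m\<close> and
    cannot be smaller.\<close>
  obtain m where m: "\<And>n. card (f m) \<le> card (f n)"
    using ex_has_least_nat[of "\<lambda>_. True" 0 "\<lambda>n. card (f n)"] by auto
  have "f n = f m" if "n \<ge> m" for n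
    using lift_Suc_antimono_le[of f, OF dec that] m assms(1,2)
    by (meson card_subset_eq card_mono finite_subset le_antisym)
  then show ?thesis by blast
qed

text \<open>There are \<open>2 * card Q + 1\<close> indices, and fibres of size at most 2 would
  account for only \<open>2 * card Q\<close> of them.\<close>

lemma pigeonhole_three:
  assumes "finite Q" and "f ` {..2 * card Q} \<subseteq> Q"
  shows "\<exists>i j k. i \<noteq> j \<and> i \<noteq> k \<and> j \<noteq> k \<and> i \<le> 2 * card Q \<and> j \<le> 2 * card Q \<and> k \<le> 2 * card Q
    \<and> f i = f j \<and> f i = f k"
proof (rule ccontr)
  assume neg: "\<not> ?thesis"
  let ?V = "\<lambda>c. {i \<in> {..2 * card Q}. f i = c}"
  have "card (?V c) \<le> 2" for c
  proof (rule ccontr)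
    assume "\<not> card (?V c) \<le> 2"
    then have "3 \<le> card (?V c)" by linarith
    then obtain W where "W \<subseteq> ?V c" "card W = 3"
      by (meson obtain_subset_with_card_n)
    then obtain i j k where "{i, j, k} \<subseteq> ?V c" "i \<noteq> j" "i \<noteq> k" "j \<noteq> k"
      by (auto simp: card_3_iff)
    then have "i \<le> 2 * card Q" "j \<le> 2 * card Q" "k \<le> 2 * card Q" "f i = f j" "f i = f k" by auto
    then show False using neg \<open>i \<noteq> j\<close> \<open>i \<noteq> k\<close> \<open>j \<noteq> k\<close> by blast
  qed
  then have "(\<Sum>c\<in>Q. card (?V c)) \<le> card Q * 2"
    using sum_bounded_above[of Q "\<lambda>c. card (?V c)" 2] by simp
  then have "card (\<Union>c\<in>Q. ?V c) \<le> card Q * 2"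
    using card_UN_le[OF assms(1), of ?V] by linarith
  moreover have "(\<Union>c\<in>Q. ?V c) = {..2 * card Q}" using assms(2) by auto
  ultimately show False by simp
qed

section \<open>Actions with finitely many orbits on pairs\<close>

sublocale group_action \<subseteq> group G
  using group_hom group_hom.axioms(1) by auto

context group_action
begin

text \<open>Orbits of a mere subset \<open>H\<close> under the one fixed action, so that subgroups
  need no actions of their own.\<close>

definition orb :: "'a set \<Rightarrow> 'c \<Rightarrow> 'c set" where
  "orb H x = (\<lambda>h. \<phi> h x) ` H"

definition pair_orb :: "'a set \<Rightarrow> 'c \<times> 'c \<Rightarrow> ('c \<times> 'c) set" where
  "pair_orb H p = (\<lambda>h. (\<phi> h (fst p), \<phi> h (snd p))) ` H"

section \<open>Elementary facts on actions and orbits of subgroups\<close>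

lemma act_closed [simp]: "\<lbrakk>g \<in> carrier G; x \<in> E\<rbrakk> \<Longrightarrow> \<phi> g x \<in> E"
  using element_image by blast

lemma act_one [simp]: "x \<in> E \<Longrightarrow> \<phi> \<one> x = x"
  using id_eq_one by (metis restrict_apply')

lemma act_inv_act [simp]: "\<lbrakk>g \<in> carrier G; x \<in> E\<rbrakk> \<Longrightarrow> \<phi> (inv g) (\<phi> g x) = x"
  using orbit_sym_aux by blast

lemma act_act_inv [simp]: "\<lbrakk>g \<in> carrier G; x \<in> E\<rbrakk> \<Longrightarrow> \<phi> g (\<phi> (inv g) x) = x"
  using act_inv_act[of "inv g" x] by simp

lemma act_eq_iff: "\<lbrakk>g \<in> carrier G; x \<in> E; y \<in> E\<rbrakk> \<Longrightarrow> \<phi> g x = \<phi> g y \<longleftrightarrow> x = y"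
  by (metis act_inv_act)

lemma orb_subset: "\<lbrakk>H \<subseteq> carrier G; x \<in> E\<rbrakk> \<Longrightarrow> orb H x \<subseteq> E"
  by (auto simp: orb_def)

lemma orb_refl: "\<lbrakk>subgroup H G; x \<in> E\<rbrakk> \<Longrightarrow> x \<in> orb H x"
  unfolding orb_def by (metis act_one imageI subgroup.one_closed)

lemma orb_trans:
  assumes "subgroup H G" "x \<in> E" "y \<in> orb H x" "z \<in> orb H y"
  shows "z \<in> orb H x"
proof -
  obtain g h where gh: "g \<in> H" "h \<in> H" "y = \<phi> g x" "z = \<phi> h y"
    using assms by (auto simp: orb_def)
  then have "z = \<phi> (h \<otimes> g) x"
    using assms(1,2) by (simp add: composition_rule subgroup.mem_carrier)
  then show ?thesis using gh assms(1) by (auto simp: orb_def subgroup.m_closed)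
qed

lemma orb_eq:
  assumes "subgroup H G" "x \<in> E" "y \<in> orb H x"
  shows "orb H y = orb H x"
proof -
  obtain g where g: "g \<in> H" "y = \<phi> g x" using assms by (auto simp: orb_def)
  then have gG: "g \<in> carrier G" using assms(1) by (simp add: subgroup.mem_carrier)
  have "x = \<phi> (inv g) y" using g gG assms(2) by simp
  then have "x \<in> orb H y" using g assms(1) by (auto simp: orb_def subgroup.m_inv_closed)
  moreover have "y \<in> E" using g gG assms(2) by simp
  ultimately show ?thesis using orb_trans[OF assms(1)] assms(2,3) by blast
qed

lemma orb_conj:
  assumes "g \<in> carrier G" "H \<subseteq> carrier G" "x \<in> E"
  shows "orb ((\<lambda>h. g \<otimes> h \<otimes> inv g) ` H) (\<phi> g x) = \<phi> g ` orb H x"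
proof -
  have "\<phi> (g \<otimes> h \<otimes> inv g) (\<phi> g x) = \<phi> g (\<phi> h x)" if "h \<in> H" for h
    using that assms by (auto simp: composition_rule)
  then show ?thesis unfolding orb_def image_image by (rule image_cong[OF refl])
qed

lemma orb_commute:
  assumes "g \<in> carrier G" "H \<subseteq> carrier G" "x \<in> E" "\<And>h. h \<in> H \<Longrightarrow> g \<otimes> h = h \<otimes> g"
  shows "orb H (\<phi> g x) = \<phi> g ` orb H x"
proof -
  have "\<phi> h (\<phi> g x) = \<phi> g (\<phi> h x)" if "h \<in> H" for h
    using composition_rule[OF assms(3), of g h] composition_rule[OF assms(3), of h g]
      assms that by auto
  then show ?thesis unfolding orb_def image_image by (rule image_cong[OF refl])
qed

text \<open>Every pair is the image under some \<open>g\<close> of one of finitely many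
  representatives \<open>d\<close>, and its \<open>H\<close>-orbit is the image of the coset
  \<open>H #> g\<close> under evaluation at \<open>d\<close>.\<close>

lemma finite_pair_orbits_finite_index:
  assumes "subgroup H G" and "finite (rcosets H)"
    and "finite (pair_orb (carrier G) ` (E \<times> E))"
  shows "finite (pair_orb H ` (E \<times> E))"
proof -
  have "\<exists>D. pair_orb (carrier G) ` (E \<times> E) = pair_orb (carrier G) ` D \<and> D \<subseteq> E \<times> E \<and> finite D"
    using finite_subset_image[OF assms(3) subset_refl] by metis
  then obtain D where D: "finite D" "D \<subseteq> E \<times> E"
      "pair_orb (carrier G) ` (E \<times> E) = pair_orb (carrier G) ` D"
    by blast
  have "pair_orb H ` (E \<times> E) \<subseteq>
      (\<Union>d\<in>D. (\<lambda>C. (\<lambda>k. (\<phi> k (fst d), \<phi> k (snd d))) ` C) ` (rcosets H))"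
  proof
    fix P assume "P \<in> pair_orb H ` (E \<times> E)"
    then obtain p where p: "p \<in> E \<times> E" "P = pair_orb H p" by blast
    then obtain d where d: "d \<in> D" "pair_orb (carrier G) p = pair_orb (carrier G) d"
      using D(3) by (metis image_eqI imageE)
    have "p \<in> pair_orb (carrier G) p"
      unfolding pair_orb_def using p(1) by (intro image_eqI[of _ _ \<one>]) auto
    then obtain g where g: "g \<in> carrier G" "p = (\<phi> g (fst d), \<phi> g (snd d))"
      using d(2) by (auto simp: pair_orb_def)
    have "P = (\<lambda>k. (\<phi> k (fst d), \<phi> k (snd d))) ` (H #> g)"
    proof -
      have "(\<phi> h (fst p), \<phi> h (snd p)) = (\<phi> (h \<otimes> g) (fst d), \<phi> (h \<otimes> g) (snd d))" if "h \<in> H" for h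
      proof -
        have "fst d \<in> E" "snd d \<in> E" using d(1) D(2) by auto
        then show ?thesis using that g subgroup.mem_carrier[OF assms(1)] by (simp add: composition_rule)
      qed
      then have "P = (\<lambda>h. (\<phi> (h \<otimes> g) (fst d), \<phi> (h \<otimes> g) (snd d))) ` H"
        unfolding p(2) pair_orb_def by (rule image_cong[OF refl])
      then show ?thesis unfolding r_coset_def by auto
    qed
    moreover have "H #> g \<in> rcosets H" using g by (auto simp: RCOSETS_def)
    ultimately show "P \<in> (\<Union>d\<in>D. (\<lambda>C. (\<lambda>k. (\<phi> k (fst d), \<phi> k (snd d))) ` C) ` (rcosets H))"
      using d(1) by blast
  qed
  then show ?thesis by (rule finite_subset) (use D(1) assms(2) in auto)
qed

text \<open>Point orbits are the projections of the orbits of diagonal pairs.\<close>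

lemma finite_orbs_if_finite_pair_orbits:
  assumes "finite (pair_orb H ` (E \<times> E))"
  shows "finite (orb H ` E)"
proof -
  have "orb H x = fst ` pair_orb H (x, x)" for x
    by (auto simp: orb_def pair_orb_def image_image)
  then have "orb H ` E \<subseteq> (`) fst ` (pair_orb H ` (E \<times> E))" by auto
  then show ?thesis using assms finite_surj by blast
qed

text \<open>On a suitable orbit, the elements of a subgroup \<open>A'\<close> of finite index in \<open>A\<close> can be traded for
  elements of \<open>B\<close> and for elements of \<open>D\<close>, so \<open>A'\<close> acts there like a commutative group. Point
  stabilizers act on the orbit of \<open>A'\<close> by conjugation, hence almost trivially.\<close>

lemma no_three_commuting_subgroups:
  assumes A: "subgroup A G" and B: "subgroup B G" and D: "subgroup D G" and N: "subgroup N G"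
    and BN: "B \<subseteq> N" and DN: "D \<subseteq> N"
    and AN: "\<And>a n. \<lbrakk>a \<in> A; n \<in> N\<rbrakk> \<Longrightarrow> a \<otimes> n = n \<otimes> a"
    and BD: "\<And>b d. \<lbrakk>b \<in> B; d \<in> D\<rbrakk> \<Longrightarrow> b \<otimes> d = d \<otimes> b"
    and C: "C \<subseteq> E" "infinite C" "\<And>a x. \<lbrakk>a \<in> A; x \<in> C\<rbrakk> \<Longrightarrow> \<phi> a x \<in> C"
    and fin: "finite (orb A ` C)" "finite (orb B ` C)" "finite (orb D ` C)"
    and P: "P \<subseteq> A <#> N" "subgroup P G" and finP: "finite (pair_orb P ` (C \<times> C))"
  shows False
proof -
  note car = subgroup.mem_carrier[OF A] subgroup.mem_carrier[OF N] subgroup.mem_carrier[OF B]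
    subgroup.mem_carrier[OF D]
  note sub = subgroup.subset[OF A] subgroup.subset[OF N] subgroup.subset[OF B]
    subgroup.subset[OF D]
  note invA = subgroup.m_inv_closed[OF A]
  have "\<exists>x0\<in>C. infinite (orb A x0)"
  proof (rule ccontr)
    assume "\<not> ?thesis"
    then have "finite (\<Union> (orb A ` C))" using fin(1) by auto
    moreover have "C \<subseteq> \<Union> (orb A ` C)" using orb_refl[OF A] C(1) by blast
    ultimately show False using C(2) finite_subset by blast
  qed
  then obtain x0 where x0: "x0 \<in> C" "infinite (orb A x0)" by blast
  have x0E: "x0 \<in> E" using x0 C(1) by auto
  have AxC: "orb A x0 \<subseteq> C" using C(3) x0(1) by (auto simp: orb_def)

  \<comment> \<open>\<open>t\<close> takes finitely many values on \<open>C\<close>. As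
    \<open>A\<close> commutes elementwise with \<open>B\<close> and \<open>D\<close>, equality of
    \<open>t\<close>-values is preserved by \<open>A\<close>.\<close>
  define t where "t x = (orb B x, orb D x)" for x
  have fint: "finite (t ` C)"
  proof -
    have "t ` C \<subseteq> (orb B ` C) \<times> (orb D ` C)" by (auto simp: t_def)
    then show ?thesis using fin finite_subset by blast
  qed
  have t_equiv: "t (\<phi> a x) = t (\<phi> a y)" if "a \<in> A" "x \<in> E" "y \<in> E" "t x = t y" for a x y
  proof -
    have "orb B (\<phi> a z) = \<phi> a ` orb B z" "orb D (\<phi> a z) = \<phi> a ` orb D z" if "z \<in> E" for z
      using orb_commute[of a B z] orb_commute[of a D z] AN BN DN sub car \<open>a \<in> A\<close> that by blast+
    then show ?thesis using that by (simp add: t_def)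
  qed

  \<comment> \<open>The stabilizer in \<open>A\<close> of the class of \<open>x0\<close> for
    equality of \<open>t\<close>-values. Its elements move \<open>x0\<close> inside both
    \<open>orb B x0\<close> and \<open>orb D x0\<close>.\<close>
  define A' where "A' = {g \<in> A. t (\<phi> g x0) = t x0}"
  have A'A: "g \<in> A" if "g \<in> A'" for g using that by (auto simp: A'_def)
  have A'_inv: "inv g \<in> A'" if "g \<in> A'" for g
    using that t_equiv[of "inv g" "\<phi> g x0" x0] car x0E invA by (auto simp: A'_def)
  \<comment> \<open>At \<open>x0\<close>, replace \<open>g\<close> by some \<open>b\<close> in
    \<open>B\<close> and \<open>h\<close> by some \<open>d\<close> in \<open>D\<close>. Since
    \<open>g\<close> commutes with \<open>d\<close> and \<open>h\<close> with \<open>b\<close>, the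
    claim reduces to \<open>b\<close> and \<open>d\<close> commuting.\<close>
  have A'_comm: "\<phi> g (\<phi> h x0) = \<phi> h (\<phi> g x0)" if gh: "g \<in> A'" "h \<in> A'" for g h
  proof -
    have "\<phi> g x0 \<in> orb B (\<phi> g x0)" "\<phi> h x0 \<in> orb D (\<phi> h x0)"
      using orb_refl[OF B] orb_refl[OF D] gh car x0E by (auto simp: A'_def)
    then have "\<phi> g x0 \<in> orb B x0" "\<phi> h x0 \<in> orb D x0"
      using gh by (auto simp: A'_def t_def)
    then obtain b d where b: "b \<in> B" "\<phi> g x0 = \<phi> b x0" and d: "d \<in> D" "\<phi> h x0 = \<phi> d x0"
      by (auto simp: orb_def)
    have sw: "\<phi> u (\<phi> v x0) = \<phi> v (\<phi> u x0)"
      if "u \<otimes> v = v \<otimes> u" "u \<in> carrier G" "v \<in> carrier G" for u v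
      using composition_rule[OF x0E, of u v] composition_rule[OF x0E, of v u] that by simp
    have "\<phi> g (\<phi> h x0) = \<phi> d (\<phi> b x0)"
      using sw[of g d] AN[of g d] gh d b car DN by (auto simp: A'_def)
    moreover have "\<phi> h (\<phi> g x0) = \<phi> b (\<phi> d x0)"
      using sw[of h b] AN[of h b] gh d b car BN by (auto simp: A'_def)
    ultimately show ?thesis using sw[OF BD[OF b(1) d(1)] car(3)[OF b(1)] car(4)[OF d(1)]] by simp
  qed
  \<comment> \<open>Infinitely many points of \<open>orb A x0\<close> share the
    \<open>t\<close>-value of some \<open>\<phi> g0 x0\<close>; translated by \<open>inv g0\<close>
    they lie in \<open>orb A' x0\<close>.\<close>
  have inf_A': "infinite (orb A' x0)"
  proof -
    have "finite (t ` orb A x0)" using fint AxC by (meson finite_subset image_mono)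
    then obtain y0 where y0: "y0 \<in> orb A x0" "infinite {y \<in> orb A x0. t y = t y0}"
      using pigeonhole_infinite[OF x0(2)] by blast
    obtain g0 where g0: "g0 \<in> A" "y0 = \<phi> g0 x0" using y0(1) by (auto simp: orb_def)
    have "\<phi> (inv g0) y \<in> orb A' x0" if y: "y \<in> orb A x0" "t y = t y0" for y
    proof -
      obtain g where g: "g \<in> A" "y = \<phi> g x0" using y(1) by (auto simp: orb_def)
      have eq: "\<phi> (inv g0) y = \<phi> (inv g0 \<otimes> g) x0"
        using g g0 car x0E by (simp add: composition_rule)
      moreover have "t (\<phi> (inv g0) y) = t x0"
        using t_equiv[of "inv g0" y y0] y(2) g g0 car x0E invA by auto
      ultimately have "inv g0 \<otimes> g \<in> A'"
        using g g0 A invA by (auto simp: A'_def subgroup.m_closed)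
      then show ?thesis using eq by (auto simp: orb_def)
    qed
    then have "\<phi> (inv g0) ` {y \<in> orb A x0. t y = t y0} \<subseteq> orb A' x0" by auto
    moreover have "inj_on (\<phi> (inv g0)) {y \<in> orb A x0. t y = t y0}"
      by (rule inj_on_subset[OF inj_prop]) (use g0 car AxC C(1) in auto)
    ultimately show ?thesis using y0(2) finite_imageD finite_subset by blast
  qed
  have A'C: "orb A' x0 \<subseteq> C" using AxC by (auto simp: orb_def A'_def)
  \<comment> \<open>Pigeonhole on pair orbits: for infinitely many \<open>y\<close> in
    \<open>orb A' x0\<close> the pair \<open>(x0, y)\<close> lies in the \<open>P\<close>-orbit of
    one pair \<open>(x0, y0)\<close>. So each such \<open>y\<close> is the image of
    \<open>y0\<close> under a product of some \<open>u\<close> in \<open>A\<close> and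
    \<open>c\<close> in \<open>N\<close> that fixes \<open>x0\<close>.\<close>
  have "finite ((\<lambda>y. pair_orb P (x0, y)) ` orb A' x0)"
    by (rule finite_subset[OF _ finP]) (use A'C x0(1) in auto)
  then obtain y0 where y0: "y0 \<in> orb A' x0"
      "infinite {y \<in> orb A' x0. pair_orb P (x0, y) = pair_orb P (x0, y0)}" (is "infinite ?Y")
    using pigeonhole_infinite[OF inf_A'] by blast
  obtain g0 where g0: "g0 \<in> A'" "y0 = \<phi> g0 x0" using y0(1) by (auto simp: orb_def)
  have y0E: "y0 \<in> E" using g0 car x0E by (auto simp: A'_def)
  have "\<forall>y\<in>?Y. \<exists>u c. u \<in> A \<and> c \<in> N \<and> \<phi> (u \<otimes> c) x0 = x0 \<and> \<phi> (u \<otimes> c) y0 = y"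
  proof
    fix y assume y: "y \<in> ?Y"
    then have yE: "y \<in> E" using A'C C(1) by auto
    have "\<one> \<in> P" using P(2) by (rule subgroup.one_closed)
    then have "(x0, y) \<in> pair_orb P (x0, y)"
      unfolding pair_orb_def using x0E yE by (intro image_eqI[of _ _ \<one>]) auto
    then have "(x0, y) \<in> pair_orb P (x0, y0)" using y by auto
    then obtain h where "h \<in> P" "\<phi> h x0 = x0" "\<phi> h y0 = y" by (auto simp: pair_orb_def)
    moreover then obtain u c where "u \<in> A" "c \<in> N" "h = u \<otimes> c"
      using P(1) by (auto simp: set_mult_def)
    ultimately show "\<exists>u c. u \<in> A \<and> c \<in> N \<and> \<phi> (u \<otimes> c) x0 = x0 \<and> \<phi> (u \<otimes> c) y0 = y" by blast
  qed
  from bchoice[OF this] obtain u where u: "\<forall>y\<in>?Y. \<exists>c. u y \<in> A \<and> c \<in> N \<and>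
      \<phi> (u y \<otimes> c) x0 = x0 \<and> \<phi> (u y \<otimes> c) y0 = y" by blast
  from bchoice[OF u] obtain c where uc: "\<And>y. y \<in> ?Y \<Longrightarrow> u y \<in> A \<and> c y \<in> N \<and>
      \<phi> (u y \<otimes> c y) x0 = x0 \<and> \<phi> (u y \<otimes> c y) y0 = y" by blast
  \<comment> \<open>A further pigeonhole fixes the \<open>t\<close>-value of
    \<open>\<phi> (u y) x0\<close>; any two of the factors \<open>u y\<close> then differ by an
    element of \<open>A'\<close> on the right.\<close>
  have "finite ((\<lambda>y. t (\<phi> (u y) x0)) ` ?Y)"
    by (rule finite_subset[OF _ fint]) (use uc C(3) x0(1) in auto)
  then obtain y1 where y1: "y1 \<in> ?Y" "infinite {y \<in> ?Y. t (\<phi> (u y) x0) = t (\<phi> (u y1) x0)}"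
    using pigeonhole_infinite[OF y0(2)] by blast
  \<comment> \<open>Write \<open>u y2\<close> as \<open>u y1\<close> times \<open>w\<close>, with
    \<open>w\<close> in \<open>A'\<close>. Both products fix \<open>x0\<close>, so
    \<open>c y2\<close> acts on \<open>x0\<close> like \<open>inv w\<close> after
    \<open>c y1\<close>. In the resulting expression for \<open>y2\<close>, \<open>c y1\<close>
    moves to the front of the elements of \<open>A\<close>, and \<open>w\<close> cancels because
    \<open>g0\<close> and \<open>inv w\<close> commute at \<open>x0\<close>. What remains is
    \<open>y1\<close>.\<close>
  have "y2 = y1" if y2: "y2 \<in> ?Y" "t (\<phi> (u y2) x0) = t (\<phi> (u y1) x0)" for y2
  proof -
    let ?u1 = "u y1" and ?u2 = "u y2" and ?c1 = "c y1" and ?c2 = "c y2"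
    have uA: "?u1 \<in> A" "?u2 \<in> A" and cN: "?c1 \<in> N" "?c2 \<in> N" using uc y1 y2 by blast+
    note uG = car(1)[OF uA(1)] car(1)[OF uA(2)] and cG = car(2)[OF cN(1)] car(2)[OF cN(2)]
    have g0A: "g0 \<in> A" using g0 A'A by auto
    note gG = car(1)[OF g0A]
    define w where "w = inv ?u1 \<otimes> ?u2"
    have wA: "w \<in> A" using uA A invA by (auto simp: w_def subgroup.m_closed)
    note wG = car(1)[OF wA]
    have "\<phi> w x0 = \<phi> (inv ?u1) (\<phi> ?u2 x0)" using uG x0E by (simp add: w_def composition_rule)
    then have "t (\<phi> w x0) = t x0"
      using t_equiv[of "inv ?u1" "\<phi> ?u2 x0" "\<phi> ?u1 x0"] y2(2) uA invA uG x0E by simp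
    then have w': "w \<in> A'" using wA by (auto simp: A'_def)
    have u2: "?u2 = ?u1 \<otimes> w" using uG by (simp add: w_def m_assoc[symmetric])
    have swap: "\<phi> a (\<phi> n x) = \<phi> n (\<phi> a x)" if "a \<in> A" "n \<in> N" "x \<in> E" for a n x
      using composition_rule[of x a n] composition_rule[of x n a] AN[of a n] car that by simp
    have yi: "\<phi> (u y) (\<phi> (c y) x0) = x0" "y = \<phi> (u y) (\<phi> g0 (\<phi> (c y) x0))" if "y \<in> ?Y" for y
    proof -
      have *: "u y \<in> A" "c y \<in> N" "\<phi> (u y \<otimes> c y) x0 = x0" "\<phi> (u y \<otimes> c y) y0 = y"
        using uc[OF that] by auto
      then show "\<phi> (u y) (\<phi> (c y) x0) = x0" using x0E car by (simp add: composition_rule)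
      show "y = \<phi> (u y) (\<phi> g0 (\<phi> (c y) x0))"
        using * y0E car x0E gG g0(2) swap[OF g0A *(2) x0E] by (simp add: composition_rule)
    qed
    have c2: "\<phi> ?c2 x0 = \<phi> (inv w) (\<phi> ?c1 x0)"
    proof -
      have "\<phi> ?u1 (\<phi> ?c1 x0) = \<phi> ?u1 (\<phi> w (\<phi> ?c2 x0))"
        using yi(1)[OF y1(1)] yi(1)[OF y2(1)] uG wG cG x0E u2 by (simp add: composition_rule)
      then have "\<phi> ?c1 x0 = \<phi> w (\<phi> ?c2 x0)" using uG wG cG x0E act_eq_iff by simp
      then show ?thesis using wG cG x0E by simp
    qed
    have "y2 = \<phi> ?u1 (\<phi> w (\<phi> g0 (\<phi> (inv w) (\<phi> ?c1 x0))))"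
      using yi(2)[OF y2(1)] c2 u2 uG wG gG cG x0E by (simp add: composition_rule)
    also have "\<dots> = \<phi> ?u1 (\<phi> ?c1 (\<phi> w (\<phi> g0 (\<phi> (inv w) x0))))"
      using swap[OF invA[OF wA] cN(1) x0E] swap[OF g0A cN(1), of "\<phi> (inv w) x0"]
        swap[OF wA cN(1), of "\<phi> g0 (\<phi> (inv w) x0)"] x0E wG gG by simp
    also have "\<phi> g0 (\<phi> (inv w) x0) = \<phi> (inv w) (\<phi> g0 x0)"
      using A'_comm[OF g0(1) A'_inv[OF w']] .
    also have "\<phi> w (\<phi> (inv w) (\<phi> g0 x0)) = \<phi> g0 x0" using wG gG x0E by simp
    also have "\<phi> ?u1 (\<phi> ?c1 (\<phi> g0 x0)) = y1"
      using yi(2)[OF y1(1)] swap[OF g0A cN(1) x0E] by simp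
    finally show ?thesis .
  qed
  then have "{y \<in> ?Y. t (\<phi> (u y) x0) = t (\<phi> (u y1) x0)} \<subseteq> {y1}" by blast
  then show False using y1(2) finite_subset by blast
qed

end

section \<open>Groups generated by commuting local subgroups\<close>

context group
begin

lemma inv_mult_cancel_left:
  assumes "g \<in> carrier G" "x \<in> carrier G"
  shows "inv g \<otimes> (g \<otimes> x) = x" "g \<otimes> (inv g \<otimes> x) = x"
  using assms by (simp_all add: m_assoc[symmetric])

lemma generate_commute_elem:
  assumes "X \<subseteq> carrier G" "y \<in> carrier G" "\<And>x. x \<in> X \<Longrightarrow> x \<otimes> y = y \<otimes> x" "a \<in> generate G X"
  shows "a \<otimes> y = y \<otimes> a"
  using assms(4)
proof (induction rule: generate.induct)
  case one
  then show ?case using assms(2) by simp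
next
  case (incl h)
  then show ?case using assms(3) by blast
next
  case (inv h)
  then have h: "h \<in> carrier G" "h \<otimes> y = y \<otimes> h" using assms(1,3) by auto
  have "inv h \<otimes> y = inv h \<otimes> (y \<otimes> h) \<otimes> inv h" using h(1) assms(2) by (simp add: m_assoc)
  also have "\<dots> = y \<otimes> inv h" using h assms(2) by (simp add: h(2)[symmetric] m_assoc[symmetric])
  finally show ?case .
next
  case (eng a b)
  then have ab: "a \<in> carrier G" "b \<in> carrier G" using generate_in_carrier[OF assms(1)] by auto
  have "a \<otimes> b \<otimes> y = a \<otimes> y \<otimes> b" using ab assms(2) eng.IH(2) by (simp add: m_assoc)
  also have "\<dots> = y \<otimes> (a \<otimes> b)" using ab assms(2) eng.IH(1) by (simp add: m_assoc)
  finally show ?case .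
qed

lemma generate_commute:
  assumes "X \<subseteq> carrier G" "Y \<subseteq> carrier G" "\<And>x y. \<lbrakk>x \<in> X; y \<in> Y\<rbrakk> \<Longrightarrow> x \<otimes> y = y \<otimes> x"
    and "a \<in> generate G X" "b \<in> generate G Y"
  shows "a \<otimes> b = b \<otimes> a"
proof (rule generate_commute_elem[OF assms(1) _ _ assms(4)])
  show "b \<in> carrier G" using generate_in_carrier[OF assms(2,5)] .
  show "x \<otimes> b = b \<otimes> x" if "x \<in> X" for x
    by (rule generate_commute_elem[OF assms(2) _ _ assms(5), symmetric])
      (use assms(1,3) that in auto)
qed

text \<open>To multiply two products \<open>a b\<close> and \<open>a' b'\<close>, move
  \<open>a'\<close> past \<open>b\<close>.\<close>

lemma generate_Un_commute:
  assumes X: "X \<subseteq> carrier G" and Y: "Y \<subseteq> carrier G"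
    and comm: "\<And>x y. \<lbrakk>x \<in> X; y \<in> Y\<rbrakk> \<Longrightarrow> x \<otimes> y = y \<otimes> x"
  shows "generate G (X \<union> Y) \<subseteq> generate G X <#> generate G Y"
proof
  fix g assume "g \<in> generate G (X \<union> Y)"
  then show "g \<in> generate G X <#> generate G Y"
  proof (induction rule: generate.induct)
    case one
    have "\<one> \<otimes> \<one> \<in> generate G X <#> generate G Y"
      unfolding set_mult_def using generate.one by blast
    then show ?case by simp
  next
    case (incl h)
    then have "h \<in> carrier G" using X Y by auto
    then have "h = h \<otimes> \<one>" "h = \<one> \<otimes> h" by auto
    then show ?case using incl unfolding set_mult_def by (blast intro: generate.one generate.incl)
  next
    case (inv h)
    then have "h \<in> carrier G" using X Y by auto
    then have "inv h = inv h \<otimes> \<one>" "inv h = \<one> \<otimes> inv h" by auto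
    then show ?case using inv unfolding set_mult_def by (blast intro: generate.one generate.inv)
  next
    case (eng g h)
    then obtain a b a' b' where *: "a \<in> generate G X" "b \<in> generate G Y" "g = a \<otimes> b"
      "a' \<in> generate G X" "b' \<in> generate G Y" "h = a' \<otimes> b'"
      unfolding set_mult_def by blast
    moreover have car: "a \<in> carrier G" "b \<in> carrier G" "a' \<in> carrier G" "b' \<in> carrier G"
      using * generate_in_carrier X Y by blast+
    moreover have "a' \<otimes> b = b \<otimes> a'" using generate_commute[OF X Y comm] * by blast
    then have "a' \<otimes> (b \<otimes> b') = b \<otimes> (a' \<otimes> b')" using car by (simp add: m_assoc[symmetric])
    ultimately have "g \<otimes> h = (a \<otimes> a') \<otimes> (b \<otimes> b')" by (simp add: m_assoc)
    then show ?case unfolding set_mult_def using * generate.eng[of _ G] by blast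
  qed
qed

lemma generate_conj:
  assumes "g \<in> carrier G" "X \<subseteq> carrier G" "Y \<subseteq> carrier G"
    and "\<And>x. x \<in> X \<Longrightarrow> g \<otimes> x \<otimes> inv g \<in> Y" and "h \<in> generate G X"
  shows "g \<otimes> h \<otimes> inv g \<in> generate G Y"
  using assms(5)
proof (induction rule: generate.induct)
  case one
  then show ?case using assms(1) generate.one by simp
next
  case (incl h)
  then show ?case by (intro generate.incl assms(4))
next
  case (inv h)
  then have h: "h \<in> carrier G" "g \<otimes> h \<otimes> inv g \<in> Y" using assms by auto
  have "g \<otimes> inv h \<otimes> inv g = inv (g \<otimes> h \<otimes> inv g)"
    using h assms(1) by (simp add: inv_mult_group m_assoc)
  then show ?case using generate.inv[OF h(2)] by simp
next
  case (eng a b)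
  then have ab: "a \<in> carrier G" "b \<in> carrier G" using generate_in_carrier[OF assms(2)] by auto
  have "g \<otimes> (a \<otimes> b) \<otimes> inv g = (g \<otimes> a \<otimes> inv g) \<otimes> (g \<otimes> b \<otimes> inv g)"
    using ab assms(1) by (simp add: m_assoc inv_mult_cancel_left)
  then show ?case using generate.eng[OF eng.IH] by simp
qed

end

text \<open>The features of a branch group on which the argument rests: \<open>L n\<close> are the
  levels, \<open>\<tau>\<close> is the action on vertices, \<open>U v\<close> the rigid stabilizer
  of \<open>v\<close>. Of the tree order only \<open>U_decreasing\<close> remains.\<close>

locale level_rigid_group = group G for G (structure) +
  fixes L :: "nat \<Rightarrow> 'v set" and \<tau> :: "'a \<Rightarrow> 'v \<Rightarrow> 'v" and U :: "'v \<Rightarrow> 'a set"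
  assumes finite_L: "finite (L n)"
    and L_unbounded: "\<exists>n\<ge>m. k < card (L n)"
    and tau_closed: "\<lbrakk>g \<in> carrier G; v \<in> L n\<rbrakk> \<Longrightarrow> \<tau> g v \<in> L n"
    and tau_one: "v \<in> L n \<Longrightarrow> \<tau> \<one> v = v"
    and tau_mult: "\<lbrakk>g \<in> carrier G; h \<in> carrier G; v \<in> L n\<rbrakk> \<Longrightarrow> \<tau> (g \<otimes> h) v = \<tau> g (\<tau> h v)"
    and tau_transitive: "\<lbrakk>v \<in> L n; w \<in> L n\<rbrakk> \<Longrightarrow> \<exists>g\<in>carrier G. \<tau> g v = w"
    and U_carrier: "v \<in> L n \<Longrightarrow> U v \<subseteq> carrier G"
    and U_conj: "\<lbrakk>g \<in> carrier G; v \<in> L n; h \<in> U v\<rbrakk> \<Longrightarrow> g \<otimes> h \<otimes> inv g \<in> U (\<tau> g v)"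
    and U_commute: "\<lbrakk>v \<in> L n; w \<in> L n; v \<noteq> w; g \<in> U v; h \<in> U w\<rbrakk> \<Longrightarrow> g \<otimes> h = h \<otimes> g"
    and U_decreasing: "v \<in> L (Suc n) \<Longrightarrow> U v \<subseteq> generate G (\<Union>v\<in>L n. U v)"
    and finite_index: "finite (rcosets (generate G (\<Union>v\<in>L n. U v)))"
begin

text \<open>In the notation of the overview this is \<open>R S\<close>, and \<open>gen (L n)\<close>
  is \<open>R n\<close>.\<close>

definition gen :: "'v set \<Rightarrow> 'a set" where
  "gen S = generate G (\<Union>v\<in>S. U v)"

lemma U_Union_carrier: "S \<subseteq> L n \<Longrightarrow> (\<Union>v\<in>S. U v) \<subseteq> carrier G"
  using U_carrier by blast

lemma subgroup_gen: "S \<subseteq> L n \<Longrightarrow> subgroup (gen S) G"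
  unfolding gen_def by (rule generate_is_subgroup[OF U_Union_carrier])

lemma gen_carrier: "S \<subseteq> L n \<Longrightarrow> gen S \<subseteq> carrier G"
  by (rule subgroup.subset[OF subgroup_gen])

lemma gen_mono: "S \<subseteq> T \<Longrightarrow> gen S \<subseteq> gen T"
  unfolding gen_def by (intro mono_generate UN_mono) auto

lemma gen_commute:
  assumes "S \<subseteq> L n" "T \<subseteq> L n" "S \<inter> T = {}" "a \<in> gen S" "b \<in> gen T"
  shows "a \<otimes> b = b \<otimes> a"
proof (rule generate_commute[OF U_Union_carrier[OF assms(1)] U_Union_carrier[OF assms(2)]])
  fix x y assume "x \<in> (\<Union>v\<in>S. U v)" "y \<in> (\<Union>v\<in>T. U v)"
  then obtain v w where "v \<in> S" "x \<in> U v" "w \<in> T" "y \<in> U w" by blast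
  then show "x \<otimes> y = y \<otimes> x" using assms U_commute[of v n w x y] by blast
qed (use assms in \<open>auto simp: gen_def\<close>)

text \<open>For complementary subsets of \<open>L n\<close> this splits \<open>gen (L n)\<close>
  into two commuting factors; for a singleton it peels off one vertex.\<close>

lemma gen_Un:
  assumes "S \<subseteq> L n" "T \<subseteq> L n" "S \<inter> T = {}"
  shows "gen (S \<union> T) \<subseteq> gen S <#> gen T"
proof -
  have "x \<otimes> y = y \<otimes> x" if xy: "x \<in> (\<Union>v\<in>S. U v)" "y \<in> (\<Union>v\<in>T. U v)" for x y
    by (rule gen_commute[OF assms]) (use xy in \<open>auto simp: gen_def intro: generate.incl\<close>)
  from generate_Un_commute[OF U_Union_carrier[OF assms(1)] U_Union_carrier[OF assms(2)] this]
  show ?thesis by (simp add: gen_def UN_Un)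
qed

lemma tau_image: "\<lbrakk>g \<in> carrier G; S \<subseteq> L n\<rbrakk> \<Longrightarrow> \<tau> g ` S \<subseteq> L n"
  using tau_closed by blast

lemma tau_inv: "\<lbrakk>g \<in> carrier G; v \<in> L n\<rbrakk> \<Longrightarrow> \<tau> (inv g) (\<tau> g v) = v"
  using tau_mult[of "inv g" g v n] tau_one[of v n] by simp

lemma gen_conj_subset:
  assumes "g \<in> carrier G" "S \<subseteq> L n" "h \<in> gen S"
  shows "g \<otimes> h \<otimes> inv g \<in> gen (\<tau> g ` S)"
  unfolding gen_def
proof (rule generate_conj[OF assms(1) U_Union_carrier[OF assms(2)]
      U_Union_carrier[OF tau_image[OF assms(1,2)]]])
  show "g \<otimes> x \<otimes> inv g \<in> (\<Union>v\<in>\<tau> g ` S. U v)" if "x \<in> (\<Union>v\<in>S. U v)" for x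
    using that U_conj[OF assms(1)] assms(2) by blast
qed (use assms(3) in \<open>simp add: gen_def\<close>)

text \<open>The reverse inclusion is \<open>gen_conj_subset\<close> for
  \<open>inv g\<close>.\<close>

lemma gen_conj:
  assumes "g \<in> carrier G" "S \<subseteq> L n"
  shows "(\<lambda>h. g \<otimes> h \<otimes> inv g) ` gen S = gen (\<tau> g ` S)"
proof
  show "(\<lambda>h. g \<otimes> h \<otimes> inv g) ` gen S \<subseteq> gen (\<tau> g ` S)"
    using gen_conj_subset[OF assms] by blast
  have "\<tau> (inv g) ` \<tau> g ` S = S"
    using tau_inv[OF assms(1)] assms(2) by (force simp: image_image)
  then have *: "inv g \<otimes> x \<otimes> g \<in> gen S" if "x \<in> gen (\<tau> g ` S)" for x
    using gen_conj_subset[of "inv g" "\<tau> g ` S" n x] tau_image[OF assms] assms(1) that by simp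
  show "gen (\<tau> g ` S) \<subseteq> (\<lambda>h. g \<otimes> h \<otimes> inv g) ` gen S"
  proof
    fix x assume x: "x \<in> gen (\<tau> g ` S)"
    then have "x \<in> carrier G" using gen_carrier[OF tau_image[OF assms]] by blast
    then have "x = g \<otimes> (inv g \<otimes> x \<otimes> g) \<otimes> inv g"
      using assms(1) by (simp add: m_assoc inv_mult_cancel_left)
    then show "x \<in> (\<lambda>h. g \<otimes> h \<otimes> inv g) ` gen S" using *[OF x] by blast
  qed
qed

lemma tau_image_L: "g \<in> carrier G \<Longrightarrow> \<tau> g ` L n = L n"
proof
  assume g: "g \<in> carrier G"
  show "\<tau> g ` L n \<subseteq> L n" using tau_image[OF g] by blast
  have "v = \<tau> g (\<tau> (inv g) v)" if "v \<in> L n" for v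
    using tau_inv[of "inv g" v n] g that by simp
  then show "L n \<subseteq> \<tau> g ` L n" using tau_closed[of "inv g"] g by blast
qed

lemma gen_L_antimono: "m \<le> n \<Longrightarrow> gen (L n) \<subseteq> gen (L m)"
proof (rule lift_Suc_antimono_le)
  show "gen (L (Suc n)) \<subseteq> gen (L n)" for n
    unfolding gen_def[of "L (Suc n)"]
    by (rule generate_subgroup_incl[OF _ subgroup_gen[OF order_refl]])
      (use U_decreasing[of _ n] in \<open>auto simp: gen_def\<close>)
qed

text \<open>Averaging: the proportion of group elements that move a given point of \<open>S\<close> to a given
  point of \<open>T\<close> is \<open>1 / card (L n)\<close>.\<close>

lemma exists_disjoint_translate:
  assumes "S \<subseteq> L n" "T \<subseteq> L n" "card S * card T < card (L n)"
  shows "\<exists>g\<in>carrier G. \<tau> g ` S \<inter> T = {}"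
proof (rule ccontr)
  assume neg: "\<not> ?thesis"
  \<comment> \<open>The group may be infinite, so the averaging runs over the finitely many maps
    that it induces on \<open>L n\<close>.\<close>
  define \<Gamma> where "\<Gamma> = (\<lambda>g. restrict (\<tau> g) (L n)) ` carrier G"
  define \<Gamma>' where "\<Gamma>' s t = {f \<in> \<Gamma>. f s = t}" for s t
  have "\<Gamma> \<subseteq> L n \<rightarrow>\<^sub>E L n" using tau_closed by (auto simp: \<Gamma>_def)
  then have fin: "finite \<Gamma>" using finite_L by (meson finite_PiE finite_subset)
  \<comment> \<open>Following each map by an element that takes \<open>t\<close> to
    \<open>t'\<close> embeds \<open>\<Gamma>' s t\<close> into
    \<open>\<Gamma>' s t'\<close>.\<close>
  have le: "card (\<Gamma>' s t) \<le> card (\<Gamma>' s t')" if st: "s \<in> L n" "t \<in> L n" "t' \<in> L n" for s t t'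
  proof -
    obtain g where g: "g \<in> carrier G" "\<tau> g t = t'" using tau_transitive[OF st(2,3)] by blast
    define F where "F f = restrict (\<lambda>v. \<tau> g (f v)) (L n)" for f
    have "inj_on F \<Gamma>"
    proof (rule inj_onI)
      fix f f' assume f: "f \<in> \<Gamma>" "f' \<in> \<Gamma>" "F f = F f'"
      show "f = f'"
      proof
        fix v
        show "f v = f' v"
        proof (cases "v \<in> L n")
          case True
          then have "f v \<in> L n" "f' v \<in> L n" using f tau_closed by (auto simp: \<Gamma>_def)
          moreover have "\<tau> g (f v) = \<tau> g (f' v)" using fun_cong[OF f(3), of v] True by (simp add: F_def)
          ultimately show ?thesis using tau_inv[OF g(1)] by metis
        qed (use f in \<open>auto simp: \<Gamma>_def\<close>)
      qed
    qed
    moreover have "F f \<in> \<Gamma>' s t'" if f: "f \<in> \<Gamma>' s t" for f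
    proof -
      obtain h where h: "h \<in> carrier G" "f = restrict (\<tau> h) (L n)" using f by (auto simp: \<Gamma>'_def \<Gamma>_def)
      then have "F f = restrict (\<tau> (g \<otimes> h)) (L n)" using g by (auto simp: F_def tau_mult)
      moreover have "F f s = t'" using f st g by (simp add: \<Gamma>'_def F_def)
      ultimately show ?thesis using g h by (auto simp: \<Gamma>'_def \<Gamma>_def)
    qed
    ultimately have "card (\<Gamma>' s t) = card (F ` \<Gamma>' s t)" "F ` \<Gamma>' s t \<subseteq> \<Gamma>' s t'"
      by (auto intro!: card_image[symmetric] inj_on_subset[of F \<Gamma>] simp: \<Gamma>'_def)
    then show ?thesis using fin by (simp add: card_mono \<Gamma>'_def)
  qed
  \<comment> \<open>The sets \<open>\<Gamma>' s t'\<close> for varying \<open>t'\<close> are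
    disjoint and at least as large as \<open>\<Gamma>' s t\<close>.\<close>
  have share: "card (L n) * card (\<Gamma>' s t) \<le> card \<Gamma>" if st: "s \<in> L n" "t \<in> L n" for s t
  proof -
    have "card (L n) * card (\<Gamma>' s t) = (\<Sum>t'\<in>L n. card (\<Gamma>' s t))" by simp
    also have "\<dots> \<le> (\<Sum>t'\<in>L n. card (\<Gamma>' s t'))" using le st by (intro sum_mono)
    also have "\<dots> = card (\<Union>t'\<in>L n. \<Gamma>' s t')"
      by (rule card_UN_disjoint[symmetric]) (use finite_L fin in \<open>auto simp: \<Gamma>'_def\<close>)
    also have "\<dots> \<le> card \<Gamma>" by (rule card_mono[OF fin]) (auto simp: \<Gamma>'_def)
    finally show ?thesis .
  qed
  have finST: "finite (S \<times> T)" using assms finite_L finite_subset by blast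
  \<comment> \<open>If every translate of \<open>S\<close> meets \<open>T\<close>, then
    \<open>card S * card T\<close> sets, each a share of at most \<open>1 / card (L n)\<close>,
    exhaust \<open>\<Gamma>\<close>.\<close>
  have "\<Gamma> \<subseteq> (\<Union>(s, t)\<in>S \<times> T. \<Gamma>' s t)"
  proof
    fix f assume f: "f \<in> \<Gamma>"
    then obtain g where g: "g \<in> carrier G" "f = restrict (\<tau> g) (L n)" by (auto simp: \<Gamma>_def)
    then obtain s where s: "s \<in> S" "\<tau> g s \<in> T" using neg by blast
    then have "f s = \<tau> g s" using g assms(1) by auto
    then have "f \<in> \<Gamma>' s (\<tau> g s)" using f by (simp add: \<Gamma>'_def)
    then show "f \<in> (\<Union>(s, t)\<in>S \<times> T. \<Gamma>' s t)" using s by blast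
  qed
  then have "card \<Gamma> \<le> card (\<Union>(s, t)\<in>S \<times> T. \<Gamma>' s t)"
    by (rule card_mono[rotated]) (rule finite_subset[OF _ fin], auto simp: \<Gamma>'_def)
  also have "\<dots> \<le> (\<Sum>st\<in>S \<times> T. card (\<Gamma>' (fst st) (snd st)))"
    using card_UN_le[OF finST, of "\<lambda>st. \<Gamma>' (fst st) (snd st)"] by (simp add: case_prod_beta)
  finally have "card (L n) * card \<Gamma> \<le> (\<Sum>st\<in>S \<times> T. card (L n) * card (\<Gamma>' (fst st) (snd st)))"
    by (simp add: sum_distrib_left[symmetric])
  also have "\<dots> \<le> (\<Sum>st\<in>S \<times> T. card \<Gamma>)" using share assms(1,2) by (intro sum_mono) (auto simp: subset_iff)
  also have "\<dots> = card S * card T * card \<Gamma>" by (simp add: card_cartesian_product)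
  finally have "card (L n) \<le> card S * card T \<or> card \<Gamma> = 0" by auto
  moreover have "\<Gamma> \<noteq> {}" by (auto simp: \<Gamma>_def)
  ultimately show False using assms(3) fin by auto
qed

text \<open>The union of \<open>Suc k\<close> translates has at most \<open>Suc k * card S\<close>
  elements, so \<open>exists_disjoint_translate\<close> finds one more translate that avoids
  it.\<close>

lemma exists_disjoint_translates:
  assumes "S \<subseteq> L n" "card S * (k * card S) < card (L n)"
  shows "\<exists>g. (\<forall>i<Suc k. g i \<in> carrier G) \<and> (\<forall>i<Suc k. \<forall>j<i. \<tau> (g i) ` S \<inter> \<tau> (g j) ` S = {})"
  using assms(2)
proof (induction k)
  case 0
  show ?case by (rule exI[of _ "\<lambda>_. \<one>"]) auto
next
  case (Suc k)
  have "card S * (k * card S) \<le> card S * (Suc k * card S)" by simp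
  then obtain g where g: "\<And>i. i < Suc k \<Longrightarrow> g i \<in> carrier G"
      "\<And>i j. \<lbrakk>i < Suc k; j < i\<rbrakk> \<Longrightarrow> \<tau> (g i) ` S \<inter> \<tau> (g j) ` S = {}"
    using Suc by (metis le_less_trans)
  define T where "T = (\<Union>i<Suc k. \<tau> (g i) ` S)"
  have finS: "finite S" using assms(1) finite_L finite_subset by blast
  have "card T \<le> (\<Sum>i<Suc k. card (\<tau> (g i) ` S))" unfolding T_def by (rule card_UN_le) simp
  also have "\<dots> \<le> (\<Sum>i<Suc k. card S)" by (intro sum_mono card_image_le finS)
  also have "\<dots> = Suc k * card S" by simp
  finally have "card S * card T \<le> card S * (Suc k * card S)" by (rule mult_le_mono2)
  then have "card S * card T < card (L n)" using Suc.prems by linarith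
  moreover have "T \<subseteq> L n" using tau_image[OF g(1) assms(1)] by (auto simp: T_def)
  ultimately obtain h where h: "h \<in> carrier G" "\<tau> h ` S \<inter> T = {}"
    using exists_disjoint_translate[OF assms(1)] by blast
  show ?case
  proof (intro exI[of _ "g(Suc k := h)"] conjI allI impI)
    show "(g(Suc k := h)) i \<in> carrier G" if "i < Suc (Suc k)" for i
      using that g(1) h(1) by (auto simp: less_Suc_eq)
    show "\<tau> ((g(Suc k := h)) i) ` S \<inter> \<tau> ((g(Suc k := h)) j) ` S = {}"
      if "i < Suc (Suc k)" "j < i" for i j
    proof (cases "i = Suc k")
      case True
      then have "\<tau> (g j) ` S \<subseteq> T" using that by (auto simp: T_def)
      then show ?thesis using True that h(2) by auto
    next
      case False
      then show ?thesis using that g(2)[of i j] by simp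
    qed
  qed
qed

end

section \<open>Actions of such groups\<close>

locale level_rigid_action = level_rigid_group G L \<tau> U + group_action G E \<phi>
  for G (structure) and L :: "nat \<Rightarrow> 'v set" and \<tau> U and E and \<phi> +
  assumes finite_pair_orbits: "finite (pair_orb (carrier G) ` (E \<times> E))"
begin

abbreviation "pair_orbits \<equiv> pair_orb (carrier G) ` (E \<times> E)"

definition invariant_relation :: "('c \<times> 'c) set \<Rightarrow> bool" where
  "invariant_relation C \<longleftrightarrow>
     C \<subseteq> E \<times> E \<and> (\<forall>g\<in>carrier G. \<forall>(x, y)\<in>C. (\<phi> g x, \<phi> g y) \<in> C)"

text \<open>Encodes an invariant relation by a subset of the finite set \<open>pair_orbits\<close>,
  so that the chain lemmas for finite sets apply to relations.\<close>

lemma Union_pair_orbits_invariant_relation: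
  assumes "invariant_relation C"
  shows "\<Union>{P \<in> pair_orbits. P \<subseteq> C} = C"
proof
  show "C \<subseteq> \<Union>{P \<in> pair_orbits. P \<subseteq> C}"
  proof
    fix p assume p: "p \<in> C"
    then have pE: "p \<in> E \<times> E" using assms by (auto simp: invariant_relation_def)
    have "p \<in> pair_orb (carrier G) p"
      unfolding pair_orb_def using pE by (intro image_eqI[of _ _ \<one>]) auto
    moreover have "pair_orb (carrier G) p \<subseteq> C"
      using p assms by (auto simp: invariant_relation_def pair_orb_def split: prod.splits)
    ultimately show "p \<in> \<Union>{P \<in> pair_orbits. P \<subseteq> C}" using pE by blast
  qed
qed auto

lemma invariant_relation_eqI:
  assumes "invariant_relation C" "invariant_relation D"
    and eq: "{P \<in> pair_orbits. P \<subseteq> C} = {P \<in> pair_orbits. P \<subseteq> D}"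
  shows "C = D"
proof -
  have "C = \<Union>{P \<in> pair_orbits. P \<subseteq> C}"
    by (rule Union_pair_orbits_invariant_relation[OF assms(1), symmetric])
  also have "\<dots> = \<Union>{P \<in> pair_orbits. P \<subseteq> D}" by (simp only: eq)
  also have "\<dots> = D" by (rule Union_pair_orbits_invariant_relation[OF assms(2)])
  finally show ?thesis .
qed

lemma orb_gen_translate:
  assumes "S \<subseteq> L n" "g \<in> carrier G" "x \<in> E"
  shows "orb (gen (\<tau> g ` S)) (\<phi> g x) = \<phi> g ` orb (gen S) x"
  using orb_conj[OF assms(2) gen_carrier[OF assms(1)] assms(3)] gen_conj[OF assms(2,1)] by simp

text \<open>\<open>\<tau> g\<close> permutes \<open>L n\<close>, so every \<open>g\<close>
  normalizes \<open>gen (L n)\<close> and its orbit relation is invariant. These relations decrease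
  with \<open>n\<close>.\<close>

lemma orbits_stabilize:
  "\<exists>m. \<forall>n\<ge>m. \<forall>x\<in>E. orb (gen (L n)) x = orb (gen (L m)) x"
proof -
  define R where "R n = {(x, y). x \<in> E \<and> y \<in> orb (gen (L n)) x}" for n
  have inv: "invariant_relation (R n)" for n
    unfolding invariant_relation_def
  proof (intro conjI ballI)
    show "R n \<subseteq> E \<times> E"
      using orb_subset[OF gen_carrier[OF order_refl]] by (fastforce simp: R_def)
    show "case p of (x, y) \<Rightarrow> (\<phi> g x, \<phi> g y) \<in> R n" if "g \<in> carrier G" "p \<in> R n" for g p
      using that orb_gen_translate[OF order_refl that(1), of _ n] tau_image_L[OF that(1), of n]
      by (auto simp: R_def)
  qed
  have "{P \<in> pair_orbits. P \<subseteq> R (Suc n)} \<subseteq> {P \<in> pair_orbits. P \<subseteq> R n}" for n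
  proof -
    have "R (Suc n) \<subseteq> R n" using gen_L_antimono[of n "Suc n"] by (auto simp: R_def orb_def)
    then show ?thesis by blast
  qed
  then obtain m where m: "\<And>n. n \<ge> m \<Longrightarrow>
      {P \<in> pair_orbits. P \<subseteq> R n} = {P \<in> pair_orbits. P \<subseteq> R m}"
    using finite_decreasing_chain_stabilizes[OF finite_pair_orbits,
        of "\<lambda>n. {P \<in> pair_orbits. P \<subseteq> R n}"] by auto
  have "R n = R m" if "n \<ge> m" for n
    by (rule invariant_relation_eqI[OF inv inv m[OF that]])
  then show ?thesis by (intro exI[of _ m]) (auto simp: R_def set_eq_iff)
qed

text \<open>The number of factors needed to reach \<open>y\<close> from \<open>x\<close> is an invariant of the pair \<open>(x, y)\<close>
  under the whole group, hence is bounded independently of the level.\<close>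

lemma few_factors_suffice:
  assumes "x \<in> E" "y \<in> orb (gen (L n)) x"
  shows "\<exists>S\<subseteq>L n. card S \<le> card pair_orbits \<and> y \<in> orb (gen S) x"
proof -
  \<comment> \<open>Passing from \<open>S\<close> to its image under \<open>\<tau> g\<close> does
    not increase its size, so these relations are invariant under the whole group.\<close>
  define R where "R j = {(x, y). x \<in> E \<and> (\<exists>S\<subseteq>L n. card S \<le> j \<and> y \<in> orb (gen S) x)}" for j
  have finS: "finite S" if "S \<subseteq> L n" for S using that finite_L finite_subset by blast
  have inv: "invariant_relation (R j)" for j
    unfolding invariant_relation_def
  proof (intro conjI ballI)
    show "R j \<subseteq> E \<times> E"
    proof
      fix p assume "p \<in> R j"
      then obtain x y S where "p = (x, y)" "x \<in> E" "S \<subseteq> L n" "y \<in> orb (gen S) x"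
        by (auto simp: R_def)
      then show "p \<in> E \<times> E" using orb_subset[OF gen_carrier[of S n], of x] by auto
    qed
    show "case p of (x, y) \<Rightarrow> (\<phi> g x, \<phi> g y) \<in> R j" if g: "g \<in> carrier G" and p: "p \<in> R j" for g p
    proof -
      obtain x y S where S: "p = (x, y)" "x \<in> E" "S \<subseteq> L n" "card S \<le> j" "y \<in> orb (gen S) x"
        using p by (auto simp: R_def)
      have "card (\<tau> g ` S) \<le> j" using card_image_le[OF finS[OF S(3)], of "\<tau> g"] S(4) by simp
      moreover have "\<phi> g y \<in> orb (gen (\<tau> g ` S)) (\<phi> g x)"
        using orb_gen_translate[OF S(3) g S(2)] S(5) by simp
      ultimately show ?thesis using S tau_image[OF g S(3)] g by (auto simp: R_def)
    qed
  qed
  have mono: "R j \<subseteq> R k" if "j \<le> k" for j k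
    unfolding R_def using order_trans[OF _ that] by blast
  then have "{P \<in> pair_orbits. P \<subseteq> R j} \<subseteq> {P \<in> pair_orbits. P \<subseteq> R (Suc j)}" for j
  proof -
    have "R j \<subseteq> R (Suc j)" by (rule mono) simp
    then show ?thesis by blast
  qed
  then obtain j where j: "j \<le> card pair_orbits"
      "{P \<in> pair_orbits. P \<subseteq> R j} = {P \<in> pair_orbits. P \<subseteq> R (Suc j)}"
    using finite_increasing_chain_repeats[OF finite_pair_orbits,
        of "\<lambda>j. {P \<in> pair_orbits. P \<subseteq> R j}"] by auto
  have Rj: "R (Suc j) = R j"
    by (rule invariant_relation_eqI[OF inv inv j(2)[symmetric]])
  \<comment> \<open>One repetition suffices, since the vertices of \<open>S\<close> can be added one
    at a time. The induction hypothesis replaces \<open>b\<close> by some \<open>b'\<close> that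
    needs at most \<open>j\<close> vertices; then \<open>a\<close> times \<open>b'\<close> needs at
    most \<open>Suc j\<close>, and \<open>R (Suc j)\<close> is \<open>R j\<close>.\<close>
  have "\<forall>y\<in>orb (gen S) x. (x, y) \<in> R j" if "S \<subseteq> L n" for S
    using finS[OF that] that
  proof (induction S rule: finite_induct)
    case empty
    show ?case
    proof
      fix y assume "y \<in> orb (gen {}) x"
      then show "(x, y) \<in> R j"
        unfolding R_def using \<open>x \<in> E\<close> by (intro CollectI case_prodI conjI exI[of _ "{}"]) auto
    qed
  next
    case (insert v S)
    then have v: "{v} \<subseteq> L n" and S: "S \<subseteq> L n" by auto
    show ?case
    proof
      fix y assume "y \<in> orb (gen (insert v S)) x"
      moreover have "gen (insert v S) \<subseteq> gen {v} <#> gen S"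
        using gen_Un[OF v S] insert.hyps by simp
      ultimately obtain a b where ab: "a \<in> gen {v}" "b \<in> gen S" "y = \<phi> (a \<otimes> b) x"
        by (auto simp: orb_def set_mult_def)
      have ab_car: "a \<in> carrier G" "b \<in> carrier G" using ab gen_carrier[OF v] gen_carrier[OF S] by auto
      have "(x, \<phi> b x) \<in> R j" using insert.IH[OF S] ab(2) by (auto simp: orb_def)
      then obtain S' where S': "S' \<subseteq> L n" "card S' \<le> j" "\<phi> b x \<in> orb (gen S') x"
        by (auto simp: R_def)
      then obtain b' where b': "b' \<in> gen S'" "\<phi> b x = \<phi> b' x" by (auto simp: orb_def)
      have iS': "insert v S' \<subseteq> L n" using v S' by auto
      have "y = \<phi> (a \<otimes> b') x"
        using ab ab_car b' gen_carrier[OF S'(1)] \<open>x \<in> E\<close> by (auto simp: composition_rule)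
      moreover have "a \<otimes> b' \<in> gen (insert v S')"
        using ab(1) b'(1) gen_mono[of "{v}" "insert v S'"] gen_mono[of S' "insert v S'"]
          subgroup.m_closed[OF subgroup_gen[OF iS']] by blast
      moreover have "card (insert v S') \<le> Suc j"
        using S'(2) finS[OF S'(1)] by (simp add: card_insert_if)
      ultimately have "(x, y) \<in> R (Suc j)"
        unfolding R_def orb_def using \<open>x \<in> E\<close> iS' by blast
      then show "(x, y) \<in> R j" using Rj by simp
    qed
  qed
  from this[OF order_refl] have "(x, y) \<in> R j" using assms(2) by blast
  then have "(x, y) \<in> R (card pair_orbits)" using mono[OF j(1)] by blast
  then show ?thesis by (auto simp: R_def)
qed

text \<open>Split \<open>g\<close> into \<open>a\<close> in \<open>gen S\<close> and
  \<open>b\<close> over the remaining vertices: \<open>b\<close> commutes with \<open>gen S\<close>,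
  and \<open>a\<close> maps each \<open>gen S\<close>-orbit to itself. This provides the maps that
  the covering lemma asks for.\<close>

lemma orb_gen_normal:
  assumes S: "S \<subseteq> L n" and g: "g \<in> gen (L n)" and x: "x \<in> E"
  shows "\<phi> g ` orb (gen S) x = orb (gen S) (\<phi> g x)"
proof -
  have S': "L n - S \<subseteq> L n" by auto
  have "gen (L n) \<subseteq> gen S <#> gen (L n - S)"
    using gen_Un[OF S S'] S by (simp add: Un_absorb1)
  then obtain a b where ab: "a \<in> gen S" "b \<in> gen (L n - S)" "g = a \<otimes> b"
    using g by (auto simp: set_mult_def)
  have car: "a \<in> carrier G" "b \<in> carrier G"
    using ab gen_carrier[OF S] gen_carrier[OF S'] by auto
  let ?z = "\<phi> b x"
  have z: "?z \<in> E" using car x by simp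
  have "orb (gen S) ?z = \<phi> b ` orb (gen S) x"
    by (rule orb_commute[OF car(2) gen_carrier[OF S] x])
      (use gen_commute[OF S' S] ab in blast)
  moreover have "\<phi> a ` orb (gen S) ?z = orb (gen S) ?z"
  proof -
    have sub: "subgroup (gen S) G" by (rule subgroup_gen[OF S])
    have "\<phi> a y \<in> orb (gen S) ?z" if a: "a \<in> gen S" and y: "y \<in> orb (gen S) ?z" for a y
      by (rule orb_trans[OF sub z y]) (use a in \<open>simp add: orb_def\<close>)
    note closed = this
    have "y \<in> \<phi> a ` orb (gen S) ?z" if y: "y \<in> orb (gen S) ?z" for y
    proof -
      have "y \<in> E" using y orb_subset[OF gen_carrier[OF S] z] by blast
      then have "y = \<phi> a (\<phi> (inv a) y)" using car by simp
      then show ?thesis using closed[OF subgroup.m_inv_closed[OF sub ab(1)] y] by blast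
    qed
    then show ?thesis using closed[OF ab(1)] by blast
  qed
  moreover have "orb (gen S) (\<phi> a ?z) = orb (gen S) ?z"
    by (rule orb_eq[OF subgroup_gen[OF S] z]) (use ab in \<open>simp add: orb_def\<close>)
  moreover have "\<phi> g y = \<phi> a (\<phi> b y)" if "y \<in> E" for y
    using ab(3) car that by (simp add: composition_rule)
  then have "\<phi> g ` orb (gen S) x = \<phi> a ` \<phi> b ` orb (gen S) x" "\<phi> g x = \<phi> a ?z"
    using orb_subset[OF gen_carrier[OF S] x] x by (auto simp: image_image intro!: image_cong)
  ultimately show ?thesis by simp
qed

text \<open>The covering lemma, applied to the orbits of \<open>gen S\<close> for the finitely many
  small \<open>S\<close>. By \<open>few_factors_suffice\<close>, the orbits of the single point
  \<open>x\<close> under these groups already form a cover.\<close>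

lemma exists_small_cofinite_set:
  assumes x: "x \<in> E"
  shows "\<exists>S\<subseteq>L n. card S \<le> card pair_orbits \<and> finite (orb (gen S) ` orb (gen (L n)) x)"
proof -
  define X where "X = orb (gen (L n)) x"
  define I where "I = {S. S \<subseteq> L n \<and> card S \<le> card pair_orbits}"
  have finI: "finite I"
    by (rule finite_subset[of _ "Pow (L n)"]) (auto simp: I_def finite_L)
  have sub: "subgroup (gen (L n)) G" by (rule subgroup_gen[OF order_refl])
  have XE: "X \<subseteq> E" unfolding X_def by (rule orb_subset[OF gen_carrier[OF order_refl] x])
  have xX: "x \<in> X" unfolding X_def by (rule orb_refl[OF sub x])
  have clsX: "orb (gen S) y \<subseteq> X" if S: "S \<in> I" and y: "y \<in> X" for S y
  proof -
    have "orb (gen S) y \<subseteq> orb (gen (L n)) y"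
      using gen_mono[of S "L n"] S by (auto simp: I_def orb_def)
    then show ?thesis using orb_eq[OF sub x, of y] y by (simp add: X_def)
  qed
  have "\<exists>S\<in>I. finite ((\<lambda>y. orb (gen S) y) ` X)"
  proof (rule Neumann_covering[where F = "I \<times> {x}"])
    show "finite I" by (rule finI)
    show "X \<noteq> {}" using xX by blast
    show "y \<in> orb (gen S) y" if "S \<in> I" "y \<in> X" for S y
      using orb_refl[OF subgroup_gen] that XE by (auto simp: I_def)
    show "orb (gen S) y \<subseteq> X" if "S \<in> I" "y \<in> X" for S y
      using clsX that .
    show "orb (gen S) z = orb (gen S) y" if "S \<in> I" "y \<in> X" "z \<in> orb (gen S) y" for S y z
      using orb_eq[OF subgroup_gen, of S n y z] that XE by (auto simp: I_def)
    show "\<exists>p. p ` X \<subseteq> X \<and> p y = z \<and> (\<forall>S\<in>I. \<forall>w\<in>X. p ` orb (gen S) w = orb (gen S) (p w))"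
      if yz: "y \<in> X" "z \<in> X" for y z
    proof -
      have "z \<in> orb (gen (L n)) y" using orb_eq[OF sub x, of y] yz by (simp add: X_def)
      then obtain g where g: "g \<in> gen (L n)" "z = \<phi> g y" by (auto simp: orb_def)
      have "\<phi> g w \<in> X" if "w \<in> X" for w
        using orb_trans[OF sub x, of w "\<phi> g w"] that g(1) by (auto simp: X_def orb_def)
      moreover have "\<phi> g ` orb (gen S) w = orb (gen S) (\<phi> g w)" if "S \<in> I" "w \<in> X" for S w
        using orb_gen_normal[of S n g w] that g(1) XE by (auto simp: I_def)
      ultimately show ?thesis using g(2) by (intro exI[of _ "\<phi> g"]) auto
    qed
    show "finite (I \<times> {x})" "I \<times> {x} \<subseteq> I \<times> X" using finI xX by auto
    show "X \<subseteq> (\<Union>(S, y)\<in>I \<times> {x}. orb (gen S) y)"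
    proof
      fix y assume "y \<in> X"
      then obtain S where "S \<in> I" "y \<in> orb (gen S) x"
        using few_factors_suffice[OF x, of y n] by (auto simp: X_def I_def)
      then show "y \<in> (\<Union>(S, y)\<in>I \<times> {x}. orb (gen S) y)" by blast
    qed
  qed
  then show ?thesis by (auto simp: I_def X_def)
qed

theorem finite_points: "finite E"
proof (rule ccontr)
  assume infE: "infinite E"
  define r where "r = card pair_orbits"
  have finR: "finite (pair_orb (gen (L n)) ` (E \<times> E))" for n
    by (rule finite_pair_orbits_finite_index[OF subgroup_gen[OF order_refl] _ finite_pair_orbits])
      (use finite_index[of n] in \<open>simp add: gen_def\<close>)
  obtain m where m: "\<And>n x. \<lbrakk>n \<ge> m; x \<in> E\<rbrakk> \<Longrightarrow> orb (gen (L n)) x = orb (gen (L m)) x"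
    using orbits_stabilize by blast
  \<comment> \<open>Taken at level \<open>m\<close>, so that \<open>n\<close> can be chosen in terms
    of \<open>card Q\<close>; by the choice of \<open>m\<close> these are also the orbits at every
    deeper level.\<close>
  define Q where "Q = orb (gen (L m)) ` E"
  have finQ: "finite Q" unfolding Q_def by (rule finite_orbs_if_finite_pair_orbits[OF finR])
  have "E \<subseteq> \<Union>Q" using orb_refl[OF subgroup_gen[OF order_refl]] by (auto simp: Q_def)
  then have "\<exists>X\<in>Q. infinite X" using finQ infE by (meson finite_Union finite_subset)
  then obtain x where x: "x \<in> E" "infinite (orb (gen (L m)) x)" by (auto simp: Q_def)
  \<comment> \<open>Leaves room in level \<open>n\<close> for \<open>2 * card Q + 1\<close> disjoint
    translates of any set of at most \<open>r\<close> vertices.\<close>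
  obtain n where n: "n \<ge> m" "r * (2 * card Q * r) < card (L n)" using L_unbounded by blast
  obtain S where S: "S \<subseteq> L n" "card S \<le> r" "finite (orb (gen S) ` orb (gen (L n)) x)"
    using exists_small_cofinite_set[OF x(1), of n] by (auto simp: r_def)
  have "card S * (2 * card Q * card S) \<le> r * (2 * card Q * r)"
    using S(2) by (intro mult_le_mono) auto
  then have "card S * (2 * card Q * card S) < card (L n)" using n(2) by linarith
  from exists_disjoint_translates[OF S(1) this] obtain g
    where g: "\<forall>i<Suc (2 * card Q). g i \<in> carrier G"
      "\<forall>i<Suc (2 * card Q). \<forall>j<i. \<tau> (g i) ` S \<inter> \<tau> (g j) ` S = {}" by blast
  have g_car: "g i \<in> carrier G" if "i \<le> 2 * card Q" for i using g(1) that by simp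
  have disj: "\<tau> (g i) ` S \<inter> \<tau> (g j) ` S = {}"
    if "i \<le> 2 * card Q" "j \<le> 2 * card Q" "i \<noteq> j" for i j
  proof (cases "j < i")
    case True
    then show ?thesis using g(2) that(1) by simp
  next
    case False
    then have "\<tau> (g j) ` S \<inter> \<tau> (g i) ` S = {}" using g(2) that by simp
    then show ?thesis by (simp only: Int_commute)
  qed
  have "(\<lambda>i. orb (gen (L m)) (\<phi> (g i) x)) ` {..2 * card Q} \<subseteq> Q"
    using g_car x(1) by (auto simp: Q_def)
  from pigeonhole_three[OF finQ this] obtain i j k where
    ijk: "i \<noteq> j" "i \<noteq> k" "j \<noteq> k" "i \<le> 2 * card Q" "j \<le> 2 * card Q" "k \<le> 2 * card Q"
    and same: "orb (gen (L m)) (\<phi> (g i) x) = orb (gen (L m)) (\<phi> (g j) x)"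
      "orb (gen (L m)) (\<phi> (g i) x) = orb (gen (L m)) (\<phi> (g k) x)"
    by blast
  \<comment> \<open>The common orbit of the three translated points: the image of the orbit of
    \<open>x\<close> under each of \<open>g i\<close>, \<open>g j\<close> and
    \<open>g k\<close>.\<close>
  define C where "C = orb (gen (L n)) (\<phi> (g i) x)"
  define T where "T l = \<tau> (g l) ` S" for l
  have TL: "T l \<subseteq> L n" if "l \<in> {i, j, k}" for l
    using tau_image[OF g_car S(1)] that ijk by (auto simp: T_def)
  have C: "C = \<phi> (g l) ` orb (gen (L n)) x" if "l \<in> {i, j, k}" for l
  proof -
    have gl: "g l \<in> carrier G" using g_car that ijk by auto
    have gi: "g i \<in> carrier G" using g_car ijk by auto
    have "C = orb (gen (L m)) (\<phi> (g i) x)"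
      unfolding C_def using m[OF n(1), of "\<phi> (g i) x"] gi x(1) by simp
    also have "\<dots> = orb (gen (L m)) (\<phi> (g l) x)" using same that by auto
    also have "\<dots> = orb (gen (L n)) (\<phi> (g l) x)" using m[OF n(1), of "\<phi> (g l) x"] gl x(1) by simp
    also have "\<dots> = \<phi> (g l) ` orb (gen (L n)) x"
      using orb_gen_translate[OF order_refl gl x(1), of n] tau_image_L[OF gl, of n] by simp
    finally show ?thesis .
  qed
  have XE: "orb (gen (L n)) x \<subseteq> E" by (rule orb_subset[OF gen_carrier[OF order_refl] x(1)])
  \<comment> \<open>\<open>g l\<close> carries the \<open>gen S\<close>-orbits in the orbit of
    \<open>x\<close> to the \<open>gen (T l)\<close>-orbits in \<open>C\<close>.\<close>
  have finT: "finite (orb (gen (T l)) ` C)" if "l \<in> {i, j, k}" for l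
  proof -
    have gl: "g l \<in> carrier G" using g_car that ijk by auto
    have "orb (gen (T l)) ` C = (`) (\<phi> (g l)) ` (orb (gen S) ` orb (gen (L n)) x)"
      unfolding C[OF that] T_def image_image
      by (rule image_cong) (use XE orb_gen_translate[OF S(1) gl] in auto)
    then show ?thesis using S(3) by simp
  qed
  have CE: "C \<subseteq> E" unfolding C_def
    by (rule orb_subset[OF gen_carrier[OF order_refl]]) (use g_car ijk x(1) in auto)
  have gi: "g i \<in> carrier G" using g_car ijk by auto
  have Ln: "L n = T i \<union> (L n - T i)" using TL[of i] by auto
  show False
  \<comment> \<open>The complement of \<open>T i\<close> contains \<open>T j\<close> and
    \<open>T k\<close>, so its group serves as \<open>N\<close>; together with
    \<open>gen (T i)\<close> it makes up all of \<open>gen (L n)\<close>, which has finitely many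
    orbits on pairs.\<close>
  proof (rule no_three_commuting_subgroups[of "gen (T i)" "gen (T j)" "gen (T k)"
        "gen (L n - T i)" C "gen (L n)"])
    show "subgroup (gen (T i)) G" "subgroup (gen (T j)) G" "subgroup (gen (T k)) G"
      "subgroup (gen (L n - T i)) G" "subgroup (gen (L n)) G"
      using TL by (auto intro: subgroup_gen)
    have "T j \<subseteq> L n - T i" "T k \<subseteq> L n - T i"
      using TL[of j] TL[of k] disj[of j i] disj[of k i] ijk by (auto simp: T_def)
    then show "gen (T j) \<subseteq> gen (L n - T i)" "gen (T k) \<subseteq> gen (L n - T i)"
      using gen_mono by blast+
    show "a \<otimes> b = b \<otimes> a" if "a \<in> gen (T i)" "b \<in> gen (L n - T i)" for a b
      by (rule gen_commute[OF TL _ _ that]) auto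
    show "a \<otimes> b = b \<otimes> a" if "a \<in> gen (T j)" "b \<in> gen (T k)" for a b
      by (rule gen_commute[OF TL TL _ that]) (use disj[of j k] ijk in \<open>auto simp: T_def\<close>)
    show "C \<subseteq> E" by (rule CE)
    have "infinite (orb (gen (L n)) x)" using x m[OF n(1) x(1)] by simp
    moreover have "inj_on (\<phi> (g i)) (orb (gen (L n)) x)"
      using inj_prop[OF gi] XE by (rule inj_on_subset)
    ultimately show "infinite C" using C[of i] finite_imageD by auto
    show "\<phi> a y \<in> C" if "a \<in> gen (T i)" "y \<in> C" for a y
    proof -
      have "a \<in> gen (L n)" using that(1) gen_mono[OF TL[of i]] by auto
      then have "\<phi> a y \<in> orb (gen (L n)) y" by (simp add: orb_def)
      then show ?thesis
        using orb_trans[OF subgroup_gen[OF order_refl], of "\<phi> (g i) x" y n "\<phi> a y"] that(2) gi x(1)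
        by (simp add: C_def)
    qed
    show "finite (orb (gen (T i)) ` C)" "finite (orb (gen (T j)) ` C)" "finite (orb (gen (T k)) ` C)"
      using finT by auto
    show "gen (L n) \<subseteq> gen (T i) <#> gen (L n - T i)"
      using gen_Un[OF TL, of i "L n - T i"] Ln by auto
    show "finite (pair_orb (gen (L n)) ` (C \<times> C))"
      by (rule finite_subset[OF _ finR[of n]]) (use CE in auto)
  qed
qed

end

section \<open>Rigid stabilizers in branch groups\<close>

lemma vertices_append: "u @ [a] \<in> vertices A \<longleftrightarrow> u \<in> vertices A \<and> a \<in> A (length u)"
  by (auto simp: vertices_def nth_append less_Suc_eq)

lemma level_vertices: "v \<in> level A n \<Longrightarrow> v \<in> vertices A"
  by (simp add: level_def)

lemma level_Suc: "level A (Suc n) = (\<lambda>(u, a). u @ [a]) ` (level A n \<times> A n)"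
proof
  show "level A (Suc n) \<subseteq> (\<lambda>(u, a). u @ [a]) ` (level A n \<times> A n)"
  proof
    fix v assume v: "v \<in> level A (Suc n)"
    then have "v \<noteq> []" by (auto simp: level_def)
    then obtain u a where ua: "v = u @ [a]" by (metis rev_exhaust)
    then have "(u, a) \<in> level A n \<times> A n" using v by (auto simp: level_def vertices_append)
    then show "v \<in> (\<lambda>(u, a). u @ [a]) ` (level A n \<times> A n)" using ua by force
  qed
qed (auto simp: level_def vertices_append)

lemma card_level_Suc: "card (level A (Suc n)) = card (level A n) * card (A n)"
proof -
  have "inj_on (\<lambda>(u, a). u @ [a]) (level A n \<times> A n)" by (auto simp: inj_on_def)
  then show ?thesis by (simp add: level_Suc card_image card_cartesian_product)
qed

lemma level_0: "level A 0 = {[]}"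
  by (auto simp: level_def)

lemma (in rooted_tree) finite_level: "finite (level A n)"
  by (induction n) (simp_all add: level_0 level_Suc finite_alphabet)

lemma (in rooted_tree) less_card_level: "n < card (level A n)"
proof (induction n)
  case (Suc n)
  have "card (level A n) * 2 \<le> card (level A (Suc n))"
    unfolding card_level_Suc by (intro mult_le_mono card_alphabet) simp
  then show ?case using Suc by simp
qed (simp add: level_0)

section \<open>Tree automorphisms preserve length and prefixes\<close>

lemma adjacent_snoc: "adjacent u (u @ [a])"
  by (simp add: adjacent_def)

lemma adjacent_cases:
  assumes "adjacent v w"
  obtains a where "w = v @ [a]" | a where "v = w @ [a]"
proof -
  have *: "\<exists>a. y = x @ [a]" if xy: "prefix x y" "length y = Suc (length x)" for x y :: "'a list"
  proof -
    obtain z where z: "y = x @ z" using xy(1) by (auto simp: prefix_def)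
    then have "length z = Suc 0" using xy(2) by simp
    then show ?thesis using z by (auto simp: length_Suc_conv)
  qed
  show thesis using assms * that unfolding adjacent_def by blast
qed

text \<open>By adjacency \<open>g (u @ [a])\<close> is a child or the parent of \<open>g u\<close>.
  It is not the parent: the root has none, and otherwise the parent of \<open>g u\<close> is by
  induction the image of the parent of \<open>u\<close>, against injectivity.\<close>

lemma tree_automorphism_snoc:
  assumes g: "g \<in> tree_automorphisms A" and "v \<in> vertices A"
  shows "length (g v) = length v \<and> (\<forall>u a. v = u @ [a] \<longrightarrow> (\<exists>b. g v = g u @ [b]))"
  using assms(2)
proof (induction v rule: rev_induct)
  case Nil
  then show ?case using g by (simp add: tree_automorphisms_def)
next
  case (snoc a u)
  then have u: "u \<in> vertices A" by (simp add: vertices_append)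
  have inj: "inj_on g (vertices A)" using g by (auto simp: tree_automorphisms_def Bij_def bij_betw_def)
  have "adjacent (g u) (g (u @ [a]))"
    using g u snoc.prems adjacent_snoc[of u a] by (auto simp: tree_automorphisms_def)
  then have "\<exists>b. g (u @ [a]) = g u @ [b]"
  proof (cases rule: adjacent_cases)
    case (2 b)
    have "u \<noteq> []" using 2 g by (auto simp: tree_automorphisms_def)
    then obtain u' a' where u': "u = u' @ [a']" by (metis rev_exhaust)
    then obtain b' where "g u = g u' @ [b']" using snoc.IH[OF u] by blast
    then have "g (u @ [a]) = g u'" using 2 by simp
    moreover have "u' \<in> vertices A" using u u' by (simp add: vertices_append)
    ultimately have "u @ [a] = u'" using inj snoc.prems by (auto dest: inj_onD)
    then show ?thesis using u' by simp
  qed blast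
  then show ?case using snoc.IH[OF u] by auto
qed

lemma tree_automorphism_length:
  "\<lbrakk>g \<in> tree_automorphisms A; v \<in> vertices A\<rbrakk> \<Longrightarrow> length (g v) = length v"
  using tree_automorphism_snoc by blast

lemma tree_automorphism_closed:
  "\<lbrakk>g \<in> tree_automorphisms A; v \<in> vertices A\<rbrakk> \<Longrightarrow> g v \<in> vertices A"
  by (auto simp: tree_automorphisms_def Bij_def bij_betw_def)

lemma tree_automorphism_inj:
  "\<lbrakk>g \<in> tree_automorphisms A; v \<in> vertices A; w \<in> vertices A; g v = g w\<rbrakk> \<Longrightarrow> v = w"
  by (auto simp: tree_automorphisms_def Bij_def bij_betw_def dest: inj_onD)

lemma tree_automorphism_prefix:
  assumes g: "g \<in> tree_automorphisms A" and "w \<in> vertices A" "prefix v w"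
  shows "prefix (g v) (g w)"
  using assms(2,3)
proof (induction w rule: rev_induct)
  case (snoc a w)
  show ?case
  proof (cases "v = w @ [a]")
    case False
    then have "prefix (g v) (g w)" using snoc by (simp add: vertices_append)
    moreover obtain b where "g (w @ [a]) = g w @ [b]"
      using tree_automorphism_snoc[OF g snoc.prems(1)] by blast
    ultimately show ?thesis by (simp add: prefix_prefix)
  qed simp
qed simp

text \<open>A point \<open>g u\<close> outside the subtree would be fixed by \<open>g\<close>, and
  injectivity would give \<open>g u = u\<close>.\<close>

lemma rist_subtree_closed:
  assumes "G \<subseteq> tree_automorphisms A" "g \<in> rist A G v" "u \<in> subtree A v"
  shows "g u \<in> subtree A v"
proof (rule ccontr)
  assume neg: "g u \<notin> subtree A v"
  have g: "g \<in> tree_automorphisms A" using assms by (auto simp: rist_def)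
  have u: "u \<in> vertices A" using assms(3) by (simp add: subtree_def)
  have gu: "g u \<in> vertices A" by (rule tree_automorphism_closed[OF g u])
  then have "g (g u) = g u" using neg assms(2) by (simp add: rist_def)
  then have "g u = u" using tree_automorphism_inj[OF g gu u] by simp
  then show False using neg assms(3) by simp
qed

text \<open>Distinct words of equal length have no common extension, so the two maps have disjoint
  supports.\<close>

lemma rist_commute:
  assumes G: "G \<subseteq> tree_automorphisms A" and vw: "length v = length w" "v \<noteq> w"
    and g: "g \<in> rist A G v" and h: "h \<in> rist A G w" and u: "u \<in> vertices A"
  shows "g (h u) = h (g u)"
proof -
  have disj: "subtree A v \<inter> subtree A w = {}"
    using vw prefix_same_cases by (fastforce simp: subtree_def prefix_def)
  consider "u \<in> subtree A v" | "u \<in> subtree A w" | "u \<notin> subtree A v" "u \<notin> subtree A w" by blast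
  then show ?thesis
  proof cases
    case 1
    then have "g u \<in> subtree A v" by (rule rist_subtree_closed[OF G g])
    then have "h (g u) = g u" using h disj by (auto simp: rist_def subtree_def)
    moreover have "h u = u" using h disj 1 u by (auto simp: rist_def)
    ultimately show ?thesis by simp
  next
    case 2
    then have "h u \<in> subtree A w" by (rule rist_subtree_closed[OF G h])
    then have "g (h u) = h u" using g disj by (auto simp: rist_def subtree_def)
    moreover have "g u = u" using g disj 2 u by (auto simp: rist_def)
    ultimately show ?thesis by simp
  next
    case 3
    then show ?thesis using g h u by (simp add: rist_def)
  qed
qed

text \<open>Passing to the parent vertex enlarges the subtree; this yields
  \<open>U_decreasing\<close>.\<close>

lemma rist_butlast: "rist A G v \<subseteq> rist A G (butlast v)"
proof -
  have "subtree A v \<subseteq> subtree A (butlast v)"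
    using prefix_order.trans[OF prefixeq_butlast] by (auto simp: subtree_def)
  then show ?thesis by (auto simp: rist_def)
qed

section \<open>Branch groups as level rigid groups\<close>

context branch_group
begin

lemma automorphisms: "G \<subseteq> tree_automorphisms A"
  using subgroup.subset[OF subgroup_AutTree] by (simp add: AutTree_def)

lemma group_G: "group ((AutTree A)\<lparr>carrier := G\<rparr>)"
  by (rule subgroup.subgroup_is_group[OF subgroup_AutTree group_AutTree])

lemma mult_apply:
  assumes "g \<in> G" "h \<in> G" "v \<in> vertices A"
  shows "(g \<otimes>\<^bsub>(AutTree A)\<lparr>carrier := G\<rparr>\<^esub> h) v = g (h v)"
  using assms automorphisms
  by (auto simp: AutTree_def BijGroup_def tree_automorphisms_def compose_eq subset_iff)

lemma one_apply: "v \<in> vertices A \<Longrightarrow> \<one>\<^bsub>(AutTree A)\<lparr>carrier := G\<rparr>\<^esub> v = v"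
  by (simp add: AutTree_def BijGroup_def)

text \<open>Moves the generation from the full automorphism group into \<open>G\<close>, where the
  abstract locale expects it.\<close>

lemma rist_level_eq_generate:
  "rist_level A G n = generate ((AutTree A)\<lparr>carrier := G\<rparr>) (\<Union>v\<in>level A n. rist A G v)"
  unfolding rist_level_def
  by (rule group.generate_consistent[OF group_AutTree _ subgroup_AutTree, symmetric])
    (auto simp: rist_def)

lemma level_rigid_group:
  "level_rigid_group ((AutTree A)\<lparr>carrier := G\<rparr>) (level A) (\<lambda>g. g) (rist A G)"
proof -
  let ?G = "(AutTree A)\<lparr>carrier := G\<rparr>"
  interpret group ?G by (rule group_G)
  have aut: "g \<in> tree_automorphisms A" if "g \<in> G" for g using automorphisms that by blast
  show ?thesis
  proof unfold_locales
    show "finite (level A n)" for n by (rule finite_level)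
    show "\<exists>n\<ge>m. k < card (level A n)" for m k
      using less_card_level[of "max m k"] by (intro exI[of _ "max m k"]) auto
    show "g v \<in> level A n" if "g \<in> carrier ?G" "v \<in> level A n" for g v n
      using that tree_automorphism_closed[OF aut, of g v] tree_automorphism_length[OF aut, of g v]
      by (simp add: level_def)
    show "\<one>\<^bsub>?G\<^esub> v = v" if "v \<in> level A n" for v n
      by (rule one_apply[OF level_vertices[OF that]])
    show "(g \<otimes>\<^bsub>?G\<^esub> h) v = g (h v)" if "g \<in> carrier ?G" "h \<in> carrier ?G" "v \<in> level A n" for g h v n
      using mult_apply[of g h v] level_vertices[OF that(3)] that(1,2) by simp
    show "\<exists>g\<in>carrier ?G. g v = w" if "v \<in> level A n" "w \<in> level A n" for v w n
      using level_transitive that by simp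
    show "rist A G v \<subseteq> carrier ?G" for v by (auto simp: rist_def)
    show "g \<otimes>\<^bsub>?G\<^esub> h \<otimes>\<^bsub>?G\<^esub> inv\<^bsub>?G\<^esub> g \<in> rist A G (g v)"
      if "g \<in> carrier ?G" "v \<in> level A n" "h \<in> rist A G v" for g v h n
    proof -
      let ?i = "inv\<^bsub>?G\<^esub> g"
      have g: "g \<in> G" and h: "h \<in> G" using that by (auto simp: rist_def)
      have i: "?i \<in> G" using inv_closed[OF that(1)] by simp
      have gh: "g \<otimes>\<^bsub>?G\<^esub> h \<in> G" and ghi: "g \<otimes>\<^bsub>?G\<^esub> h \<otimes>\<^bsub>?G\<^esub> ?i \<in> G"
        using m_closed[of g h] m_closed[of "g \<otimes>\<^bsub>?G\<^esub> h" ?i] g h i by auto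
      have "(g \<otimes>\<^bsub>?G\<^esub> h \<otimes>\<^bsub>?G\<^esub> ?i) w = w" if w: "w \<in> vertices A - subtree A (g v)" for w
      proof -
        have iw: "?i w \<in> vertices A" using tree_automorphism_closed[OF aut[OF i]] w by simp
        have giw: "g (?i w) = w"
          using mult_apply[OF g i, of w] one_apply[of w] r_inv[of g] g w by simp
        \<comment> \<open>\<open>g\<close> preserves prefixes, so if \<open>v\<close> were a prefix
          of the preimage of \<open>w\<close>, then \<open>g v\<close> would be a prefix of
          \<open>w\<close>.\<close>
        have "?i w \<notin> subtree A v"
          using tree_automorphism_prefix[OF aut[OF g] iw, of v] giw w by (auto simp: subtree_def)
        then have "h (?i w) = ?i w" using \<open>h \<in> rist A G v\<close> iw by (simp add: rist_def)
        then show ?thesis using mult_apply[OF gh i, of w] mult_apply[OF g h iw] giw w by simp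
      qed
      then show ?thesis using ghi by (auto simp: rist_def)
    qed
    show "g \<otimes>\<^bsub>?G\<^esub> h = h \<otimes>\<^bsub>?G\<^esub> g"
      if "v \<in> level A n" "w \<in> level A n" "v \<noteq> w" "g \<in> rist A G v" "h \<in> rist A G w" for v w n g h
    proof -
      have g: "g \<in> G" and h: "h \<in> G" using that by (auto simp: rist_def)
      have "compose (vertices A) g h = compose (vertices A) h g"
        unfolding compose_def
        by (rule restrict_ext, rule rist_commute[OF automorphisms _ that(3-5)])
          (use that in \<open>auto simp: level_def\<close>)
      moreover have "g \<in> Bij (vertices A)" "h \<in> Bij (vertices A)"
        using aut[OF g] aut[OF h] by (auto simp: tree_automorphisms_def)
      ultimately show ?thesis by (simp add: AutTree_def BijGroup_def)
    qed
    show "rist A G v \<subseteq> generate ?G (\<Union>v\<in>level A n. rist A G v)"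
      if "v \<in> level A (Suc n)" for v n
    proof -
      have "butlast v \<in> level A n" using that by (auto simp: level_Suc)
      then show ?thesis using rist_butlast[of A G v] by (auto intro: generate.incl)
    qed
    show "finite (rcosets\<^bsub>?G\<^esub> (generate ?G (\<Union>v\<in>level A n. rist A G v)))" for n
      using finite_index_rist_level[of n] by (simp add: rist_level_eq_generate)
  qed
qed

end

text \<open>On pairs from \<open>\<Omega>\<close> the restriction built into
  \<open>diagonal_action\<close> has no effect, so both kinds of orbits coincide.\<close>

lemma (in quasi_2_transitive_action) finite_pair_orbits:
  "finite (pair_orb (carrier G) ` (\<Omega> \<times> \<Omega>))"
proof -
  have "orbits G (\<Omega> \<times> \<Omega>) (diagonal_action \<Omega> \<phi>) = pair_orb (carrier G) ` (\<Omega> \<times> \<Omega>)"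
    unfolding orbits_def Setcompr_eq_image
    by (rule image_cong) (auto simp: orbit_def diagonal_action_def pair_orb_def)
  then show ?thesis using finite_orbits_diagonal by simp
qed

theorem theorem1p1:
  fixes A :: "nat \<Rightarrow> 'a set"
    and G :: "('a list \<Rightarrow> 'a list) set"
    and \<Omega> :: "'x set"
  assumes "branch_group A G"
    and "infinite \<Omega>"
  shows "\<not> (\<exists>\<phi>. quasi_2_transitive_action ((AutTree A)\<lparr>carrier := G\<rparr>) \<Omega> \<phi>)"
proof
  assume "\<exists>\<phi>. quasi_2_transitive_action ((AutTree A)\<lparr>carrier := G\<rparr>) \<Omega> \<phi>"
  then obtain \<phi> where \<phi>: "quasi_2_transitive_action ((AutTree A)\<lparr>carrier := G\<rparr>) \<Omega> \<phi>" by blast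
  interpret q: quasi_2_transitive_action "(AutTree A)\<lparr>carrier := G\<rparr>" \<Omega> \<phi> by (rule \<phi>)
  interpret r: level_rigid_group "(AutTree A)\<lparr>carrier := G\<rparr>" "level A" "\<lambda>g. g" "rist A G"
    by (rule branch_group.level_rigid_group[OF assms(1)])
  interpret level_rigid_action "(AutTree A)\<lparr>carrier := G\<rparr>" "level A" "\<lambda>g. g" "rist A G" \<Omega> \<phi>
    by unfold_locales (rule q.finite_pair_orbits)
  show False using finite_points assms(2) by blast
qed

end
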